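(* Let $\mathbb{F}$ be a field. Up to isomorphism, every $3$-dimensional nilpotent evolution algebra over $\mathbb{F}$ is isomorphic to one of the following pairwise non-isomorphic nilpotent evolution algebras with natural basis $\{e_1,e_2,e_3\}$ (only the nonzero products of basis elements are listed), where in (3) $\alpha$ runs over a set of representatives of $\mathbb{F}^*/(\mathbb{F}^* )^2$. Writing $\mathcal{B}$ and $\mathcal{H}$ for $\mathcal{B}(\mathcal{E}\times\mathcal{E},\mathbb{F})$ and $\mathcal{H}(\mathcal{E}\times\mathcal{E},\mathbb{F})$ of the algebra $\mathcal{E}$ in question: (1) $\mathcal{E}_{3,1}$: all products are zero; $\mathcal{B}=0$, $\mathcal{H}=\langle\delta_{e_1,e_1},\delta_{e_2,e_2},\delta_{e_3,e_3}\rangle$, $ann(\mathcal{E}_{3,1})=\mathcal{E}_{3,1}$, $Aut(\mathcal{E}_{3,1})=GL(\mathcal{E}_{3,1})$. (2) $\mathcal{E}_{3,2}$: $e_1^2=e_2$; $\mathcal{B}=\langle\delta_{e_1,e_1}\rangle$, $\mathcal{H}=\langle\delta_{e_2,e_2},\delta_{e_3,e_3}\rangle$, $ann(\mathcal{E}_{3,2})=\langle e_2,e_3\rangle$, and $Aut(\mathcal{E}_{3,2})$ consists of the invertible linear maps with matrix $\begin{bmatrix} a_{11} & 0 & 0 \\ a_{21} & a_{11}^2 & a_{23} \\ a_{31} & 0 & a_{33} \end{bmatrix}$. (3) $\mathcal{E}_{3,3}^{\alpha}$: $e_1^2=e_3$, $e_2^2=\alpha e_3$; $\mathcal{B}=\langle\delta_{e_1,e_1}+\alpha\delta_{e_2,e_2}\rangle$,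 $\mathcal{H}=\langle\delta_{e_1,e_1},\delta_{e_3,e_3}\rangle$, $ann(\mathcal{E}_{3,3}^{\alpha})=\langle e_3\rangle$, and $Aut(\mathcal{E}_{3,3}^{\alpha})$ consists of the invertible linear maps with matrix $\begin{bmatrix} a_{11} & a_{12} & 0 \\ a_{21} & a_{22} & 0 \\ a_{31} & a_{32} & a_{33} \end{bmatrix}$ such that $a_{11}^2+\alpha a_{21}^2=a_{33}$, $a_{12}^2+\alpha a_{22}^2=\alpha a_{33}$ and $a_{11}a_{12}+\alpha a_{21}a_{22}=0$. (4) $\mathcal{E}_{3,4}$: $e_1^2=e_2$, $e_2^2=e_3$; $\mathcal{B}=\langle\delta_{e_1,e_1},\delta_{e_2,e_2}\rangle$, $\mathcal{H}=\langle\delta_{e_3,e_3}\rangle$, $ann(\mathcal{E}_{3,4})=\langle e_3\rangle$, and $Aut(\mathcal{E}_{3,4})$ consists of the invertible linear maps with matrix $\begin{bmatrix} a_{11} & 0 & 0 \\ 0 & a_{11}^2 & 0 \\ a_{31} & 0 & a_{11}^4 \end{bmatrix}$.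
   Context: An evolution algebra over a field $\mathbb{F}$ is a (finite-dimensional, not necessarily associative) algebra $\mathcal{E}$ having a vector space basis $\{e_1,\dots,e_n\}$, called a natural basis, with $e_ie_j=0$ for all $i\neq j$. Put $\mathcal{E}^{\langle 1\rangle}=\mathcal{E}$ and $\mathcal{E}^{\langle k+1\rangle}=\mathcal{E}^{\langle k\rangle}\mathcal{E}$ (span of products); $\mathcal{E}$ is nilpotent if $\mathcal{E}^{\langle n\rangle}=0$ for some $n\ge 1$. The annihilator is $ann(\mathcal{E})=\{x\in\mathcal{E}: x\mathcal{E}=0\}$. Isomorphism means isomorphism of $\mathbb{F}$-algebras, and $Aut(\mathcal{E})$ is the group of algebra automorphisms. $(\mathbb{F}^* )^2$ is the group of nonzero squares in $\mathbb{F}$. For an evolution algebra $\mathcal{E}$ with fixed natural basis $\{e_1,\dots,e_m\}$, let $\mathcal{Z}(\mathcal{E}\times\mathcal{E},\mathbb{F})$ be the space of bilinear forms $\theta$ on $\mathcal{E}$ with $\theta(e_i,e_j)=0$ for all $i\ne j$; let $\mathcal{B}(\mathcal{E}\times\mathcal{E},\mathbb{F})$ be the subspace of the forms $\theta_f(x,y)=f(xy)$ with $f\in Hom(\mathcal{E},\mathbb{F})$; and $\mathcal{H}(\mathcal{E}\times\mathcal{E},\mathbb{F})=\mathcal{Z}(\mathcal{E}\times\mathcal{E},\mathbb{F})/\mathcal{B}(\mathcal{E}\times\mathcal{E},\mathbb{F})$. The form $\delta_{e_i,e_i}$ takes the value $1$ on $(e_i,e_i)$ and $0$ on all other pairs of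 basis elements; when it occurs as an element of $\mathcal{H}$, its class is meant. $\langle\cdot\rangle$ denotes linear span. A linear map $\phi$ has matrix $(a_{ij})$ if $\phi(e_j)=\sum_i a_{ij}e_i$. *)

theory Defs
  imports "HOL-Analysis.Analysis" "HOL-Library.Function_Algebras" "HOL-Library.Set_Algebras"
begin

text \<open>
  A (not necessarily associative) algebra over the field \<open>'f\<close> is given by a type \<open>'v\<close>,
  a scalar multiplication \<open>s\<close> and a product \<open>m\<close>; both are passed explicitly.
\<close>

definition bilinear_map ::
  "('f::field \<Rightarrow> 'v::ab_group_add \<Rightarrow> 'v) \<Rightarrow> ('f \<Rightarrow> 'w::ab_group_add \<Rightarrow> 'w) \<Rightarrow> ('v \<Rightarrow> 'v \<Rightarrow> 'w) \<Rightarrow> bool"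
  where "bilinear_map s t b \<longleftrightarrow>
    (\<forall>x. Vector_Spaces.linear s t (\<lambda>y. b x y)) \<and> (\<forall>y. Vector_Spaces.linear s t (\<lambda>x. b x y))"

definition nonassoc_algebra ::
  "('f::field \<Rightarrow> 'v::ab_group_add \<Rightarrow> 'v) \<Rightarrow> ('v \<Rightarrow> 'v \<Rightarrow> 'v) \<Rightarrow> bool"
  where "nonassoc_algebra s m \<longleftrightarrow> vector_space s \<and> bilinear_map s s m"

definition natural_basis ::
  "('f::field \<Rightarrow> 'v::ab_group_add \<Rightarrow> 'v) \<Rightarrow> ('v \<Rightarrow> 'v \<Rightarrow> 'v) \<Rightarrow> 'v set \<Rightarrow> bool"
  where "natural_basis s m B \<longleftrightarrow>
    finite B \<and> \<not> module.dependent s B \<and> module.span s B = UNIV \<and>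
    (\<forall>b\<in>B. \<forall>c\<in>B. b \<noteq> c \<longrightarrow> m b c = 0)"

definition evolution_algebra ::
  "('f::field \<Rightarrow> 'v::ab_group_add \<Rightarrow> 'v) \<Rightarrow> ('v \<Rightarrow> 'v \<Rightarrow> 'v) \<Rightarrow> bool"
  where "evolution_algebra s m \<longleftrightarrow> nonassoc_algebra s m \<and> (\<exists>B. natural_basis s m B)"

text \<open>The index starts at 1; the value at 0 is a dummy.\<close>

fun principal_power ::
  "('f::field \<Rightarrow> 'v::ab_group_add \<Rightarrow> 'v) \<Rightarrow> ('v \<Rightarrow> 'v \<Rightarrow> 'v) \<Rightarrow> nat \<Rightarrow> 'v set"
  where
    "principal_power s m 0 = UNIV"
  | "principal_power s m (Suc 0) = UNIV"
  | "principal_power s m (Suc (Suc k)) =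
       module.span s {m x y | x y. x \<in> principal_power s m (Suc k)}"

definition nilpotent_algebra ::
  "('f::field \<Rightarrow> 'v::ab_group_add \<Rightarrow> 'v) \<Rightarrow> ('v \<Rightarrow> 'v \<Rightarrow> 'v) \<Rightarrow> bool"
  where "nilpotent_algebra s m \<longleftrightarrow> (\<exists>n\<ge>1. principal_power s m n = {0})"

definition annihilator :: "('v::ab_group_add \<Rightarrow> 'v \<Rightarrow> 'v) \<Rightarrow> 'v set"
  where "annihilator m = {x. \<forall>y. m x y = 0}"

definition algebra_iso ::
  "('f::field \<Rightarrow> 'v::ab_group_add \<Rightarrow> 'v) \<Rightarrow> ('v \<Rightarrow> 'v \<Rightarrow> 'v) \<Rightarrow>
   ('f \<Rightarrow> 'w::ab_group_add \<Rightarrow> 'w) \<Rightarrow> ('w \<Rightarrow> 'w \<Rightarrow> 'w) \<Rightarrow> ('v \<Rightarrow> 'w) \<Rightarrow> bool"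
  where "algebra_iso s m s' m' \<phi> \<longleftrightarrow>
    Vector_Spaces.linear s s' \<phi> \<and> bij \<phi> \<and> (\<forall>x y. \<phi> (m x y) = m' (\<phi> x) (\<phi> y))"

definition isomorphic_algebras ::
  "('f::field \<Rightarrow> 'v::ab_group_add \<Rightarrow> 'v) \<Rightarrow> ('v \<Rightarrow> 'v \<Rightarrow> 'v) \<Rightarrow>
   ('f \<Rightarrow> 'w::ab_group_add \<Rightarrow> 'w) \<Rightarrow> ('w \<Rightarrow> 'w \<Rightarrow> 'w) \<Rightarrow> bool"
  where "isomorphic_algebras s m s' m' \<longleftrightarrow> (\<exists>\<phi>. algebra_iso s m s' m' \<phi>)"

definition algebra_Aut ::
  "('f::field \<Rightarrow> 'v::ab_group_add \<Rightarrow> 'v) \<Rightarrow> ('v \<Rightarrow> 'v \<Rightarrow> 'v) \<Rightarrow> ('v \<Rightarrow> 'v) set"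
  where "algebra_Aut s m = {\<phi>. algebra_iso s m s m \<phi>}"

definition general_linear :: "('f::field \<Rightarrow> 'v::ab_group_add \<Rightarrow> 'v) \<Rightarrow> ('v \<Rightarrow> 'v) set"
  where "general_linear s = {\<phi>. Vector_Spaces.linear s s \<phi> \<and> bij \<phi>}"

text \<open>
  The elements of a quotient by a subspace \<open>W\<close> are the cosets \<open>v +o W\<close>. Their sum is the
  elementwise sum of sets. The summand \<open>W\<close> in the scalar multiple only matters for the scalar
  0, where it yields the zero coset \<open>W\<close> instead of \<open>{0}\<close>.
\<close>

definition quotient_scale ::
  "('f::field \<Rightarrow> 'v::ab_group_add \<Rightarrow> 'v) \<Rightarrow> 'v set \<Rightarrow> 'f \<Rightarrow> 'v set \<Rightarrow> 'v set"
  where "quotient_scale s W c C = s c ` C + W"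

definition quotient_subspace ::
  "('f::field \<Rightarrow> 'v::ab_group_add \<Rightarrow> 'v) \<Rightarrow> 'v set \<Rightarrow> 'v set set \<Rightarrow> bool"
  where "quotient_subspace s W T \<longleftrightarrow>
    W \<in> T \<and> (\<forall>C\<in>T. \<forall>D\<in>T. C + D \<in> T) \<and> (\<forall>c. \<forall>C\<in>T. quotient_scale s W c C \<in> T)"

definition quotient_span ::
  "('f::field \<Rightarrow> 'v::ab_group_add \<Rightarrow> 'v) \<Rightarrow> 'v set \<Rightarrow> 'v set set \<Rightarrow> 'v set set"
  where "quotient_span s W S = quotient_subspace s W hull S"

lemma quotient_plus_coset:
  assumes "vector_space s" "module.subspace s W"
  shows "(x +o W) + (y +o W) = (x + y) +o W"
proof -
  interpret vector_space s by fact
  have "W + W = W"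
  proof
    show "W + W \<subseteq> W" using assms(2) by (auto simp: set_plus_def subspace_add)
    show "W \<subseteq> W + W" using subspace_0[OF assms(2)] by (force simp: set_plus_def)
  qed
  then show ?thesis by (simp add: set_plus_rearrange)
qed

lemma quotient_scale_coset:
  assumes "vector_space s" "module.subspace s W"
  shows "quotient_scale s W c (x +o W) = s c x +o W"
proof -
  interpret vector_space s by fact
  show ?thesis
  proof
    show "quotient_scale s W c (x +o W) \<subseteq> s c x +o W"
      using assms(2)
      by (auto simp: quotient_scale_def elt_set_plus_def set_plus_def scale_right_distrib add.assoc
          subspace_add subspace_scale)
    show "s c x +o W \<subseteq> quotient_scale s W c (x +o W)"
    proof
      fix y assume "y \<in> s c x +o W"
      then obtain w where w: "w \<in> W" "y = s c x + w" by (auto simp: elt_set_plus_def)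
      have "x \<in> x +o W" using subspace_0[OF assms(2)] by (force simp: elt_set_plus_def)
      then show "y \<in> quotient_scale s W c (x +o W)"
        using w by (auto simp: quotient_scale_def set_plus_def)
    qed
  qed
qed

definition form_scale :: "'f::field \<Rightarrow> ('v \<Rightarrow> 'v \<Rightarrow> 'f) \<Rightarrow> ('v \<Rightarrow> 'v \<Rightarrow> 'f)"
  where "form_scale c \<theta> = (\<lambda>x y. c * \<theta> x y)"

lemma vector_space_form_scale: "vector_space form_scale"
  by unfold_locales (auto simp: form_scale_def fun_eq_iff algebra_simps)

definition Z_forms ::
  "('f::field \<Rightarrow> 'v::ab_group_add \<Rightarrow> 'v) \<Rightarrow> 'v set \<Rightarrow> ('v \<Rightarrow> 'v \<Rightarrow> 'f) set"
  where "Z_forms s B =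
    {\<theta>. bilinear_map s (*) \<theta> \<and> (\<forall>b\<in>B. \<forall>c\<in>B. b \<noteq> c \<longrightarrow> \<theta> b c = 0)}"

definition B_forms ::
  "('f::field \<Rightarrow> 'v::ab_group_add \<Rightarrow> 'v) \<Rightarrow> ('v \<Rightarrow> 'v \<Rightarrow> 'v) \<Rightarrow> ('v \<Rightarrow> 'v \<Rightarrow> 'f) set"
  where "B_forms s m = {(\<lambda>x y. f (m x y)) | f. Vector_Spaces.linear s (*) f}"

definition H_forms ::
  "('f::field \<Rightarrow> 'v::ab_group_add \<Rightarrow> 'v) \<Rightarrow> ('v \<Rightarrow> 'v \<Rightarrow> 'v) \<Rightarrow> 'v set \<Rightarrow> ('v \<Rightarrow> 'v \<Rightarrow> 'f) set set"
  where "H_forms s m B = (\<lambda>\<theta>. \<theta> +o B_forms s m) ` Z_forms s B"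

definition H_span ::
  "('f::field \<Rightarrow> 'v::ab_group_add \<Rightarrow> 'v) \<Rightarrow> ('v \<Rightarrow> 'v \<Rightarrow> 'v) \<Rightarrow>
   ('v \<Rightarrow> 'v \<Rightarrow> 'f) set \<Rightarrow> ('v \<Rightarrow> 'v \<Rightarrow> 'f) set set"
  where "H_span s m S =
    quotient_span form_scale (B_forms s m) ((\<lambda>\<theta>. \<theta> +o B_forms s m) ` S)"

definition delta_form ::
  "('f::field \<Rightarrow> 'v::ab_group_add \<Rightarrow> 'v) \<Rightarrow> 'v set \<Rightarrow> 'v \<Rightarrow> 'v \<Rightarrow> ('v \<Rightarrow> 'v \<Rightarrow> 'f)"
  where "delta_form s B b c =
    (\<lambda>x y. module.representation s B x b * module.representation s B y c)"

lemma delta_form_basis: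
  assumes "vector_space s" "\<not> module.dependent s B" "x \<in> B" "y \<in> B"
  shows "delta_form s B b c x y = (if x = b \<and> y = c then 1 else 0)"
proof -
  interpret vector_space s by fact
  show ?thesis
    using assms by (auto simp: delta_form_def representation_basis)
qed

lemma bilinear_delta_form:
  assumes "vector_space s" "\<not> module.dependent s B" "module.span s B = UNIV"
  shows "bilinear_map s (*) (delta_form s B b c)"
proof -
  interpret vector_space s by fact
  have "vector_space ((*) :: 'a \<Rightarrow> 'a \<Rightarrow> 'a)"
    by unfold_locales
  then show ?thesis
    unfolding bilinear_map_def delta_form_def
    using assms
    by (auto simp: Vector_Spaces.linear_iff representation_add representation_scale algebra_simps)
qed

definition evol_mult :: "'f::field ^ 'n ^ 'n \<Rightarrow> 'f ^ 'n \<Rightarrow> 'f ^ 'n \<Rightarrow> 'f ^ 'n"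
  where "evol_mult q x y = (\<Sum>i\<in>UNIV. (x $ i * y $ i) *s q $ i)"

lemma evol_mult_axis:
  "evol_mult q (axis i 1) (axis j 1) = (if i = j then q $ i else 0)"
proof -
  have "(axis i 1 $ k * axis j 1 $ k) *s q $ k = (if k = i then if i = j then q $ i else 0 else 0)"
    for k by (auto simp: axis_def)
  then show ?thesis by (simp add: evol_mult_def)
qed

lemma bilinear_evol_mult: "bilinear_map (*s) (*s) (evol_mult q)"
  unfolding bilinear_map_def evol_mult_def
  by (auto simp: Vector_Spaces.linear_iff vec.vector_space_axioms vec_eq_iff sum.distrib
      sum_distrib_left algebra_simps)

abbreviation e\<^sub>1 :: "'f::field ^ 3" where "e\<^sub>1 \<equiv> axis 1 1"
abbreviation e\<^sub>2 :: "'f::field ^ 3" where "e\<^sub>2 \<equiv> axis 2 1"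
abbreviation e\<^sub>3 :: "'f::field ^ 3" where "e\<^sub>3 \<equiv> axis 3 1"

definition std_basis :: "('f::field ^ 3) set"
  where "std_basis = {e\<^sub>1, e\<^sub>2, e\<^sub>3}"

abbreviation \<delta>\<^sub>1 :: "'f::field ^ 3 \<Rightarrow> 'f ^ 3 \<Rightarrow> 'f" where "\<delta>\<^sub>1 \<equiv> delta_form (*s) std_basis e\<^sub>1 e\<^sub>1"
abbreviation \<delta>\<^sub>2 :: "'f::field ^ 3 \<Rightarrow> 'f ^ 3 \<Rightarrow> 'f" where "\<delta>\<^sub>2 \<equiv> delta_form (*s) std_basis e\<^sub>2 e\<^sub>2"
abbreviation \<delta>\<^sub>3 :: "'f::field ^ 3 \<Rightarrow> 'f ^ 3 \<Rightarrow> 'f" where "\<delta>\<^sub>3 \<equiv> delta_form (*s) std_basis e\<^sub>3 e\<^sub>3"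

definition E31 :: "'f::field ^ 3 \<Rightarrow> 'f ^ 3 \<Rightarrow> 'f ^ 3"
  where "E31 = evol_mult (vector [0, 0, 0])"

definition E32 :: "'f::field ^ 3 \<Rightarrow> 'f ^ 3 \<Rightarrow> 'f ^ 3"
  where "E32 = evol_mult (vector [e\<^sub>2, 0, 0])"

definition E33 :: "'f::field \<Rightarrow> 'f ^ 3 \<Rightarrow> 'f ^ 3 \<Rightarrow> 'f ^ 3"
  where "E33 \<alpha> = evol_mult (vector [e\<^sub>3, \<alpha> *s e\<^sub>3, 0])"

definition E34 :: "'f::field ^ 3 \<Rightarrow> 'f ^ 3 \<Rightarrow> 'f ^ 3"
  where "E34 = evol_mult (vector [e\<^sub>2, e\<^sub>3, 0])"

definition std_nilpotent_evolution :: "('f::field ^ 3 \<Rightarrow> 'f ^ 3 \<Rightarrow> 'f ^ 3) \<Rightarrow> bool"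
  where "std_nilpotent_evolution m \<longleftrightarrow>
    evolution_algebra (*s) m \<and> natural_basis (*s) m std_basis \<and> nilpotent_algebra (*s) m \<and>
    vector_space.dim ((*s) :: 'f \<Rightarrow> 'f ^ 3 \<Rightarrow> 'f ^ 3) UNIV = 3"

definition nonzero_squares :: "'f::field set"
  where "nonzero_squares = {c\<^sup>2 | c. c \<noteq> 0}"

definition square_classes :: "'f::field set set"
  where "square_classes = {(*) a ` nonzero_squares | a. a \<noteq> 0}"

definition square_class_representatives :: "'f::field set \<Rightarrow> bool"
  where "square_class_representatives R \<longleftrightarrow>
    0 \<notin> R \<and> (\<forall>C\<in>square_classes. \<exists>!r. r \<in> R \<inter> C)"

end

theory Submission
  imports Defs
begin

text \<open>
  In a nilpotent evolution algebra with natural basis \<open>B\<close>, write \<open>i \<rightarrow> j\<close> if \<open>j\<close> occurs in the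
  square of \<open>i\<close>. Multiplying that square by \<open>j\<close> returns a nonzero multiple of the square of \<open>j\<close>,
  so along an arrow squares move one step down the descending chain of powers. A nonempty set of
  basis vectors each of which has a predecessor in the set would therefore have its squares in
  every power, that is, all squares zero, and then there would be no arrows
  (\<open>nilpotent_basis_source\<close>). Removing sources one after the other orders a basis of three
  elements such that \<open>e\<^sub>1\<^sup>2 = a e\<^sub>2 + b e\<^sub>3\<close>, \<open>e\<^sub>2\<^sup>2 = c e\<^sub>3\<close> and \<open>e\<^sub>3\<^sup>2 = 0\<close>
  (\<open>nilpotent_evolution_isomorphic_triangular\<close>). The four normal forms are themselves members of this
  three-parameter family, and every member reaches one of them by an explicit change of basis that
  has a shape depending only on which of \<open>a\<close>, \<open>b\<close>, \<open>c\<close> vanish (\<open>triangular_normal_form\<close>). The square classes enter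
  when \<open>a = 0\<close> and \<open>b\<close>, \<open>c\<close> are nonzero: rescaling \<open>e\<^sub>2\<close> by \<open>t\<close> multiplies the invariant \<open>c / b\<close> by \<open>t\<^sup>2\<close>.

  The dimension of the annihilator separates \<open>E31\<close>, \<open>E32\<close> and the two remaining types, which differ in
  that \<open>(x x) y\<close> vanishes identically in \<open>E33 \<alpha>\<close> but not in \<open>E34\<close>. The parameter \<open>\<alpha>\<close> is the
  Gram determinant of the form \<open>x\<^sub>1 y\<^sub>1 + \<alpha> x\<^sub>2 y\<^sub>2\<close> that gives the products in \<open>E33 \<alpha>\<close>; its square class
  is an invariant because the Gram determinant of a form in two variables is multiplied by a square
  under a change of variables and under scaling
  (\<open>E33_isomorphic_imp_same_square_class\<close>). This computation
  is a polynomial identity over the integers, so characteristic 2 is no exception.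

  The remaining data are computed once for the whole triangular family and then specialised.
  A linear map is a homomorphism exactly if it respects the products of basis vectors
  (\<open>triangular_hom_iff\<close>), which gives the automorphism groups as polynomial conditions on the
  columns. A functional applied to a product depends only on the functional at \<open>e\<^sub>2\<close> and \<open>e\<^sub>3\<close>, which
  gives two generators for the space of forms \<open>f (x y)\<close> (\<open>B_forms_triangular\<close>). Cosets of a
  spanning set span the quotient (\<open>quotient_span_cosets\<close>), so the descriptions of the quotient reduce
  to equalities between spans of forms.
\<close>

section \<open>Coordinates in dimension three\<close>

lemma vec3_eq_iff: "x = y \<longleftrightarrow> x $ 1 = y $ 1 \<and> x $ 2 = y $ 2 \<and> x $ 3 = (y :: 'a ^ 3) $ 3"
  by (simp add: vec_eq_iff forall_3)

lemma axis3_coordinates: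
  "axis (1::3) (1::'f::field) $ 1 = 1" "axis (1::3) (1::'f::field) $ 2 = 0"
  "axis (1::3) (1::'f::field) $ 3 = 0"
  "axis (2::3) (1::'f::field) $ 1 = 0" "axis (2::3) (1::'f::field) $ 2 = 1"
  "axis (2::3) (1::'f::field) $ 3 = 0"
  "axis (3::3) (1::'f::field) $ 1 = 0" "axis (3::3) (1::'f::field) $ 2 = 0"
  "axis (3::3) (1::'f::field) $ 3 = 1"
  by (simp_all add: axis_def)

lemma vec3_expand: "x = x $ 1 *s e\<^sub>1 + x $ 2 *s e\<^sub>2 + x $ 3 *s (e\<^sub>3 :: 'f::field ^ 3)"
  by (simp add: vec3_eq_iff axis3_coordinates)

lemma std_basis_eq_cart_basis: "std_basis = (cart_basis :: ('f::field ^ 3) set)"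
proof
  show "cart_basis \<subseteq> (std_basis :: ('f ^ 3) set)"
  proof
    fix x :: "'f ^ 3" assume "x \<in> cart_basis"
    then obtain i where "x = axis i 1" by (auto simp: cart_basis_def)
    then show "x \<in> std_basis" using exhaust_3[of i] by (auto simp: std_basis_def)
  qed
qed (auto simp: cart_basis_def std_basis_def)

lemma independent_std_basis: "\<not> module.dependent (*s) (std_basis :: ('f::field ^ 3) set)"
  by (simp add: std_basis_eq_cart_basis independent_cart_basis)

lemma span_std_basis: "module.span (*s) (std_basis :: ('f::field ^ 3) set) = UNIV"
  by (simp add: std_basis_eq_cart_basis span_cart_basis)

lemma representation_std_basis:
  "module.representation (*s) std_basis x (axis i 1) = (x :: 'f::field ^ 3) $ i"
proof -
  have [simp]: "axis 1 1 \<in> (std_basis :: ('f ^ 3) set)" "axis 2 1 \<in> (std_basis :: ('f ^ 3) set)"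
    "axis 3 1 \<in> (std_basis :: ('f ^ 3) set)"
    by (auto simp: std_basis_def)
  note repr = vec.representation_add vec.representation_scale vec.representation_basis
    independent_std_basis span_std_basis
  show ?thesis
    by (subst vec3_expand[of x]) (use exhaust_3[of i] in \<open>auto simp: repr axis_eq_axis\<close>)
qed

lemma dim_vec3: "vec.dim (UNIV :: ('f::field ^ 3) set) = 3"
  by (simp add: card_cart_basis)

section \<open>Triangular algebras\<close>

text \<open>
  A common family for all normal forms and for every three-dimensional nilpotent evolution algebra in
  a suitably ordered basis. Row \<open>i\<close> holds the square of \<open>e\<^sub>i\<close>, so the structure matrix is strictly
  upper triangular.
\<close>

definition triangular_mult :: "'f::field \<Rightarrow> 'f \<Rightarrow> 'f \<Rightarrow> 'f ^ 3 \<Rightarrow> 'f ^ 3 \<Rightarrow> 'f ^ 3"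
  where "triangular_mult a b c = evol_mult (vector [vector [0, a, b], vector [0, 0, c], 0])"

lemma triangular_mult_coordinates:
  "triangular_mult a b c x y $ 1 = 0"
  "triangular_mult a b c x y $ 2 = a * (x $ 1 * y $ 1)"
  "triangular_mult a b c x y $ 3 = b * (x $ 1 * y $ 1) + c * (x $ 2 * y $ 2)"
  by (simp_all add: triangular_mult_def evol_mult_def sum_3)

lemma triangular_mult_commute: "triangular_mult a b c x y = triangular_mult a b c y x"
  by (simp add: vec3_eq_iff triangular_mult_coordinates mult.commute)

lemma E_eq_triangular:
  "E31 = triangular_mult 0 0 0"
  "E32 = triangular_mult 1 0 0"
  "E33 \<alpha> = triangular_mult 0 1 \<alpha>"
  "E34 = triangular_mult 1 0 1"
  by (auto simp: E31_def E32_def E33_def E34_def fun_eq_iff vec_eq_iff forall_3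
      triangular_mult_coordinates evol_mult_def sum_3 axis_def)

lemma nonassoc_algebra_triangular: "nonassoc_algebra (*s) (triangular_mult a b c)"
  by (simp add: nonassoc_algebra_def vec.vector_space_axioms bilinear_evol_mult triangular_mult_def)

text \<open>
  Each multiplication removes the first remaining coordinate, because a product involves the first
  coordinate of its factors only in coordinates 2 and 3, and the second only in coordinate 3.
  So the fourth power is zero.
\<close>

lemma std_nilpotent_evolution_triangular:
  fixes a b c :: "'f::field"
  shows "std_nilpotent_evolution (triangular_mult a b c)"
proof -
  let ?m = "triangular_mult a b c"
  have nat: "natural_basis (*s) ?m std_basis"
    unfolding natural_basis_def
    by (auto simp: independent_std_basis span_std_basis)
      (auto simp: std_basis_def triangular_mult_def evol_mult_axis)
  have sub2: "vec.subspace {x :: 'f ^ 3. x $ 1 = 0}"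
    and sub3: "vec.subspace {x :: 'f ^ 3. x $ 1 = 0 \<and> x $ 2 = 0}"
    by (auto simp: vec.subspace_def)
  have P2: "principal_power (*s) ?m 2 \<subseteq> {x. x $ 1 = 0}"
    unfolding numeral_2_eq_2 principal_power.simps
    by (rule vec.span_minimal[OF _ sub2]) (auto simp: triangular_mult_coordinates)
  have P3: "principal_power (*s) ?m 3 \<subseteq> {x. x $ 1 = 0 \<and> x $ 2 = 0}"
    unfolding numeral_3_eq_3 principal_power.simps
    by (rule vec.span_minimal[OF _ sub3])
      (use P2 in \<open>auto simp: triangular_mult_coordinates numeral_2_eq_2\<close>)
  have "principal_power (*s) ?m (Suc 3) \<subseteq> {0}"
    unfolding numeral_3_eq_3 principal_power.simps
    by (rule vec.span_minimal)
      (use P3 in \<open>auto simp: triangular_mult_coordinates numeral_3_eq_3 vec3_eq_iff\<close>)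
  moreover have "0 \<in> principal_power (*s) ?m (Suc 3)"
    by (simp add: numeral_3_eq_3 vec.span_zero)
  ultimately have "nilpotent_algebra (*s) ?m"
    unfolding nilpotent_algebra_def by (intro exI[of _ "Suc 3"]) auto
  then show ?thesis
    using nat nonassoc_algebra_triangular dim_vec3
    unfolding std_nilpotent_evolution_def evolution_algebra_def by blast
qed

section \<open>Isomorphisms\<close>

lemma isomorphic_algebras_sym:
  assumes "isomorphic_algebras s m s' m'"
  shows "isomorphic_algebras s' m' s m"
proof -
  obtain \<phi> where lin: "Vector_Spaces.linear s s' \<phi>" and "bij \<phi>"
    and mult: "\<And>x y. \<phi> (m x y) = m' (\<phi> x) (\<phi> y)"
    using assms by (auto simp: isomorphic_algebras_def algebra_iso_def)
  have f: "\<phi> (inv \<phi> x) = x" for x using \<open>bij \<phi>\<close> by (simp add: bij_is_surj surj_f_inv_f)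
  have g: "inv \<phi> (\<phi> x) = x" for x using \<open>bij \<phi>\<close> by (simp add: bij_is_inj)
  have add: "inv \<phi> (x + y) = inv \<phi> x + inv \<phi> y" for x y
  proof -
    have "\<phi> (inv \<phi> x + inv \<phi> y) = x + y" using lin by (simp add: Vector_Spaces.linear_iff f)
    then show ?thesis using g[of "inv \<phi> x + inv \<phi> y"] by simp
  qed
  have scale: "inv \<phi> (s' r x) = s r (inv \<phi> x)" for r x
  proof -
    have "\<phi> (s r (inv \<phi> x)) = s' r x" using lin by (simp add: Vector_Spaces.linear_iff f)
    then show ?thesis using g[of "s r (inv \<phi> x)"] by simp
  qed
  have "Vector_Spaces.linear s' s (inv \<phi>)"
    using lin add scale by (auto simp: Vector_Spaces.linear_iff)
  moreover have "inv \<phi> (m' x y) = m (inv \<phi> x) (inv \<phi> y)" for x y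
    by (metis f g mult)
  ultimately show ?thesis
    using \<open>bij \<phi>\<close> bij_imp_bij_inv by (auto simp: isomorphic_algebras_def algebra_iso_def)
qed

lemma isomorphic_algebras_trans:
  assumes "isomorphic_algebras s m s' m'" "isomorphic_algebras s' m' s'' m''"
  shows "isomorphic_algebras s m s'' m''"
proof -
  obtain \<phi> \<psi> where "algebra_iso s m s' m' \<phi>" "algebra_iso s' m' s'' m'' \<psi>"
    using assms by (auto simp: isomorphic_algebras_def)
  then have "algebra_iso s m s'' m'' (\<psi> \<circ> \<phi>)"
    using Vector_Spaces.linear_compose bij_comp by (fastforce simp: algebra_iso_def)
  then show ?thesis by (auto simp: isomorphic_algebras_def)
qed

lemma linear_vec3_expand:
  fixes \<phi> :: "'f::field ^ 3 \<Rightarrow> 'v::ab_group_add"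
  assumes "Vector_Spaces.linear (*s) s \<phi>"
  shows "\<phi> x = s (x $ 1) (\<phi> e\<^sub>1) + s (x $ 2) (\<phi> e\<^sub>2) + s (x $ 3) (\<phi> e\<^sub>3)"
proof -
  have "\<phi> x = \<phi> (x $ 1 *s e\<^sub>1 + x $ 2 *s e\<^sub>2 + x $ 3 *s e\<^sub>3)"
    using vec3_expand[of x] by simp
  also have "\<dots> = s (x $ 1) (\<phi> e\<^sub>1) + s (x $ 2) (\<phi> e\<^sub>2) + s (x $ 3) (\<phi> e\<^sub>3)"
    using assms by (simp add: Vector_Spaces.linear_iff)
  finally show ?thesis .
qed

lemma triangular_mult_basis:
  "triangular_mult a b c e\<^sub>1 e\<^sub>1 = a *s e\<^sub>2 + b *s e\<^sub>3"
  "triangular_mult a b c e\<^sub>2 e\<^sub>2 = c *s e\<^sub>3"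
  "triangular_mult a b c e\<^sub>3 e\<^sub>3 = 0"
  "i \<noteq> j \<Longrightarrow> triangular_mult a b c (axis i 1) (axis j 1) = 0"
  by (auto simp: triangular_mult_def evol_mult_axis vec3_eq_iff axis3_coordinates)

text \<open>
  Both sides of the homomorphism condition are bilinear, so it may be tested on pairs of basis
  vectors. The target is arbitrary: the same criterion serves for recognising a triangular basis in
  an abstract algebra, for changes of basis inside the family, and for automorphisms.
\<close>

lemma triangular_hom_iff:
  fixes \<phi> :: "'f::field ^ 3 \<Rightarrow> 'v::ab_group_add"
  assumes alg: "nonassoc_algebra s m" and lin: "Vector_Spaces.linear (*s) s \<phi>"
  shows "(\<forall>x y. \<phi> (triangular_mult a b c x y) = m (\<phi> x) (\<phi> y)) \<longleftrightarrow>
    m (\<phi> e\<^sub>1) (\<phi> e\<^sub>1) = s a (\<phi> e\<^sub>2) + s b (\<phi> e\<^sub>3) \<and>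
    m (\<phi> e\<^sub>2) (\<phi> e\<^sub>2) = s c (\<phi> e\<^sub>3) \<and> m (\<phi> e\<^sub>3) (\<phi> e\<^sub>3) = 0 \<and>
    (\<forall>i j. i \<noteq> j \<longrightarrow> m (\<phi> (axis i 1)) (\<phi> (axis j 1)) = 0)"
    (is "?hom \<longleftrightarrow> ?basis")
proof
  interpret vector_space s using alg by (simp add: nonassoc_algebra_def)
  have \<phi>add: "\<phi> (x + y) = \<phi> x + \<phi> y" and \<phi>scale: "\<phi> (r *s x) = s r (\<phi> x)" for x y r
    using lin by (auto simp: Vector_Spaces.linear_iff)
  have \<phi>0: "\<phi> 0 = 0" using \<phi>scale[of 0 0] by simp
  show ?basis if hom: ?hom
  proof -
    have *: "m (\<phi> x) (\<phi> y) = \<phi> (triangular_mult a b c x y)" for x y using hom by simp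
    show ?thesis by (simp add: * triangular_mult_basis \<phi>0 \<phi>add \<phi>scale)
  qed
  show ?hom if ?basis
  proof (intro allI)
    fix x y
    have m_add: "m (u + v) w = m u w + m v w" "m u (v + w) = m u v + m u w"
      and m_scale: "m (s r u) v = s r (m u v)" "m u (s r v) = s r (m u v)" for u v w r
      using alg by (auto simp: nonassoc_algebra_def bilinear_map_def Vector_Spaces.linear_iff)
    have off: "m (\<phi> e\<^sub>1) (\<phi> e\<^sub>2) = 0" "m (\<phi> e\<^sub>2) (\<phi> e\<^sub>1) = 0" "m (\<phi> e\<^sub>1) (\<phi> e\<^sub>3) = 0"
      "m (\<phi> e\<^sub>3) (\<phi> e\<^sub>1) = 0" "m (\<phi> e\<^sub>2) (\<phi> e\<^sub>3) = 0" "m (\<phi> e\<^sub>3) (\<phi> e\<^sub>2) = 0"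
      using \<open>?basis\<close> by auto
    show "\<phi> (triangular_mult a b c x y) = m (\<phi> x) (\<phi> y)"
      unfolding linear_vec3_expand[OF lin, of x] linear_vec3_expand[OF lin, of y]
        linear_vec3_expand[OF lin, of "triangular_mult a b c x y"]
      using \<open>?basis\<close>
      by (simp add: m_add m_scale off triangular_mult_coordinates scale_left_distrib
          scale_right_distrib mult.commute mult.left_commute)
  qed
qed

text \<open>
  In use, \<open>u\<close>, \<open>v\<close>, \<open>w\<close> are the images of \<open>e\<^sub>1\<close>, \<open>e\<^sub>2\<close>, \<open>e\<^sub>3\<close>; bijectivity says that they form a basis.
\<close>

lemma isomorphic_triangularI:
  fixes u v w :: "'v::ab_group_add" and s :: "'f::field \<Rightarrow> 'v \<Rightarrow> 'v"
  assumes alg: "nonassoc_algebra s m"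
    and bij: "bij (\<lambda>x :: 'f ^ 3. s (x $ 1) u + s (x $ 2) v + s (x $ 3) w)"
    and squares: "m u u = s a v + s b w" "m v v = s c w" "m w w = 0"
    and orthogonal: "m u v = 0" "m v u = 0" "m u w = 0" "m w u = 0" "m v w = 0" "m w v = 0"
  shows "isomorphic_algebras (*s) (triangular_mult a b c) s m"
proof -
  interpret vector_space s using alg by (simp add: nonassoc_algebra_def)
  let ?\<phi> = "\<lambda>x :: 'f ^ 3. s (x $ 1) u + s (x $ 2) v + s (x $ 3) w"
  have lin: "Vector_Spaces.linear (*s) s ?\<phi>"
    by (auto simp: Vector_Spaces.linear_iff vec.vector_space_axioms vector_space_axioms
        scale_left_distrib scale_right_distrib algebra_simps)
  have "\<forall>i j. i \<noteq> j \<longrightarrow> m (?\<phi> (axis i 1)) (?\<phi> (axis j 1)) = 0"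
    by (simp add: forall_3 axis3_coordinates orthogonal)
  then have "\<forall>x y. ?\<phi> (triangular_mult a b c x y) = m (?\<phi> x) (?\<phi> y)"
    by (subst triangular_hom_iff[OF alg lin]) (simp add: axis3_coordinates squares)
  then show ?thesis
    using lin bij by (auto simp: isomorphic_algebras_def algebra_iso_def)
qed

text \<open>
  Inside the family, injectivity suffices by finiteness of dimension, and commutativity of the
  product halves the orthogonality conditions.
\<close>

lemma isomorphic_triangular_triangularI:
  fixes u v w :: "'f::field ^ 3"
  assumes inj: "\<And>x :: 'f ^ 3. x $ 1 *s u + x $ 2 *s v + x $ 3 *s w = 0 \<Longrightarrow> x = 0"
    and squares: "triangular_mult a' b' c' u u = a *s v + b *s w"
      "triangular_mult a' b' c' v v = c *s w" "triangular_mult a' b' c' w w = 0"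
    and orthogonal: "triangular_mult a' b' c' u v = 0" "triangular_mult a' b' c' u w = 0"
      "triangular_mult a' b' c' v w = 0"
  shows "isomorphic_algebras (*s) (triangular_mult a b c) (*s) (triangular_mult a' b' c')"
proof (rule isomorphic_triangularI[OF nonassoc_algebra_triangular _ squares])
  let ?\<phi> = "\<lambda>x :: 'f ^ 3. x $ 1 *s u + x $ 2 *s v + x $ 3 *s w"
  have lin: "Vector_Spaces.linear (*s) (*s) ?\<phi>"
    by (auto simp: Vector_Spaces.linear_iff vec.vector_space_axioms vec3_eq_iff algebra_simps)
  then have "inj ?\<phi>"
    unfolding vec.linear_inj_iff_eq_0[OF lin] using inj by blast
  then show "bij ?\<phi>"
    using lin by (simp add: bij_def vec.linear_injective_imp_surjective)
  show "triangular_mult a' b' c' v u = 0" "triangular_mult a' b' c' w u = 0"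
    "triangular_mult a' b' c' w v = 0"
    using orthogonal by (simp_all add: triangular_mult_commute)
qed (fact orthogonal)+

section \<open>Normal forms in the triangular family\<close>

text \<open>
  The form in which the choice of representatives is used: the factor \<open>t\<close> is absorbed by rescaling a
  basis vector.
\<close>

lemma square_class_representative_exists:
  assumes R: "square_class_representatives R" and "d \<noteq> 0"
  shows "\<exists>\<alpha>\<in>R. \<exists>t. t \<noteq> 0 \<and> \<alpha> = d * t\<^sup>2"
proof -
  have "(*) d ` nonzero_squares \<in> square_classes"
    unfolding square_classes_def using \<open>d \<noteq> 0\<close> by blast
  then obtain \<alpha> where "\<alpha> \<in> R" "\<alpha> \<in> (*) d ` nonzero_squares"
    using R unfolding square_class_representatives_def by blast
  then show ?thesis by (auto simp: nonzero_squares_def)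
qed

lemma square_class_representative_nonzero:
  assumes "square_class_representatives R" "\<alpha> \<in> R"
  shows "\<alpha> \<noteq> 0"
  using assms unfolding square_class_representatives_def by metis

lemma square_class_representative_unique:
  assumes R: "square_class_representatives R" and "\<alpha> \<in> R" "\<beta> \<in> R"
    and "t \<noteq> 0" "\<alpha> = \<beta> * t\<^sup>2"
  shows "\<alpha> = \<beta>"
proof -
  let ?C = "(*) \<beta> ` nonzero_squares"
  have "\<beta> \<noteq> 0" using R \<open>\<beta> \<in> R\<close> by (rule square_class_representative_nonzero)
  then have "?C \<in> square_classes"
    unfolding square_classes_def by blast
  moreover have "t\<^sup>2 \<in> nonzero_squares" "1 \<in> (nonzero_squares :: 'a set)"
    using \<open>t \<noteq> 0\<close> by (auto simp: nonzero_squares_def intro: exI[of _ 1])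
  then have "\<alpha> \<in> ?C" "\<beta> \<in> ?C" using assms(5) by (auto simp: image_iff intro: bexI[of _ 1])
  ultimately show ?thesis
    using R \<open>\<alpha> \<in> R\<close> \<open>\<beta> \<in> R\<close> unfolding square_class_representatives_def by (metis IntI)
qed

text \<open>
  An isomorphism from a normal form is a choice of images for its basis. The images of basis vectors
  that are squares in the normal form are forced by the other images. In the \<open>E32\<close> cases the third
  image is any element of the annihilator that completes the basis.
\<close>

lemma triangular_normal_form:
  fixes R :: "'f::field set"
  assumes R: "square_class_representatives R"
  shows "isomorphic_algebras (*s) (E31 :: 'f ^ 3 \<Rightarrow> _) (*s) (triangular_mult a b c) \<or>
         isomorphic_algebras (*s) (E32 :: 'f ^ 3 \<Rightarrow> _) (*s) (triangular_mult a b c) \<or>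
         (\<exists>\<alpha>\<in>R. isomorphic_algebras (*s) (E33 \<alpha>) (*s) (triangular_mult a b c)) \<or>
         isomorphic_algebras (*s) (E34 :: 'f ^ 3 \<Rightarrow> _) (*s) (triangular_mult a b c)"
proof -
  note coords = vec3_eq_iff axis3_coordinates triangular_mult_coordinates
  consider "a = 0" "b = 0" "c = 0" | "c = 0" "a \<noteq> 0" | "c = 0" "a = 0" "b \<noteq> 0" | "a = 0" "b = 0" "c \<noteq> 0"
    | "a = 0" "b \<noteq> 0" "c \<noteq> 0" | "a \<noteq> 0" "c \<noteq> 0" by blast
  then show ?thesis
  proof cases
    case 1
    have "isomorphic_algebras (*s) (triangular_mult 0 0 0) (*s) (triangular_mult a b c)"
      by (rule isomorphic_triangular_triangularI[of "e\<^sub>1" "e\<^sub>2" "e\<^sub>3"])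
        (simp_all add: coords 1)
    then show ?thesis by (simp add: E_eq_triangular)
  next
    case 2
    have "isomorphic_algebras (*s) (triangular_mult 1 0 0) (*s) (triangular_mult a b c)"
      by (rule isomorphic_triangular_triangularI[of "e\<^sub>1" "a *s e\<^sub>2 + b *s e\<^sub>3" "e\<^sub>3"])
        (use 2 in \<open>auto simp: coords\<close>)
    then show ?thesis by (simp add: E_eq_triangular)
  next
    case 3
    have "isomorphic_algebras (*s) (triangular_mult 1 0 0) (*s) (triangular_mult a b c)"
      by (rule isomorphic_triangular_triangularI[of "e\<^sub>1" "b *s e\<^sub>3" "e\<^sub>2"])
        (use 3 in \<open>auto simp: coords\<close>)
    then show ?thesis by (simp add: E_eq_triangular)
  next
    case 4
    have "isomorphic_algebras (*s) (triangular_mult 1 0 0) (*s) (triangular_mult a b c)"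
      by (rule isomorphic_triangular_triangularI[of "e\<^sub>2" "c *s e\<^sub>3" "e\<^sub>1"])
        (use 4 in \<open>auto simp: coords\<close>)
    then show ?thesis by (simp add: E_eq_triangular)
  next
    case 5
    then obtain \<alpha> t where "\<alpha> \<in> R" "t \<noteq> 0" and "\<alpha> = c / b * t\<^sup>2"
      using square_class_representative_exists[OF R, of "c / b"] by auto
    then have \<alpha>: "c * (t * t) = \<alpha> * b" using 5 by (simp add: power2_eq_square)
    have "isomorphic_algebras (*s) (triangular_mult 0 1 \<alpha>) (*s) (triangular_mult a b c)"
      by (rule isomorphic_triangular_triangularI[of "e\<^sub>1" "t *s e\<^sub>2" "b *s e\<^sub>3"])
        \<comment> \<open>\<open>(t e\<^sub>2)\<^sup>2 = t\<^sup>2 c e\<^sub>3 = (c / b * t\<^sup>2) (b e\<^sub>3)\<close>, so \<open>t\<close> moves \<open>c / b\<close> to the chosen representative.\<close>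
        (use 5 \<open>t \<noteq> 0\<close> in \<open>simp_all add: coords \<alpha>\<close>)
    then show ?thesis using \<open>\<alpha> \<in> R\<close> by (auto simp: E_eq_triangular)
  next
    case 6
    have "isomorphic_algebras (*s) (triangular_mult 1 0 1) (*s) (triangular_mult a b c)"
      by (rule isomorphic_triangular_triangularI[of "e\<^sub>1" "a *s e\<^sub>2 + b *s e\<^sub>3" "(c * a\<^sup>2) *s e\<^sub>3"])
        (use 6 in \<open>auto simp: coords power2_eq_square\<close>)
    then show ?thesis by (simp add: E_eq_triangular)
  qed
qed

section \<open>Nilpotent evolution algebras have a triangular natural basis\<close>

text \<open>
  Orthogonality of the basis removes all other terms. Applied to a square, this is what turns the
  presence of \<open>j\<close> in it into a way of producing the square of \<open>j\<close> by one multiplication.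
\<close>

lemma natural_basis_mult_right:
  assumes alg: "nonassoc_algebra s m" and B: "natural_basis s m B" and "j \<in> B"
  shows "m x j = s (module.representation s B x j) (m j j)"
proof -
  interpret vector_space s using alg by (simp add: nonassoc_algebra_def)
  have fin: "finite B" and ind: "independent B" and sp: "span B = UNIV"
    and off: "\<And>b. b \<in> B \<Longrightarrow> b \<noteq> j \<Longrightarrow> m b j = 0"
    using B \<open>j \<in> B\<close> by (auto simp: natural_basis_def)
  have lin: "Vector_Spaces.linear s s (\<lambda>x. m x j)"
    using alg by (simp add: nonassoc_algebra_def bilinear_map_def)
  interpret lin: Vector_Spaces.linear s s "\<lambda>x. m x j" by (rule lin)
  have "m x j = m (\<Sum>b\<in>B. s (representation B x b) b) j"
    using sum_representation_eq[OF ind _ fin, of x] sp by simp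
  also have "\<dots> = (\<Sum>b\<in>B. s (representation B x b) (m b j))"
    by (simp add: lin.sum lin.scale)
  also have "\<dots> = s (representation B x j) (m j j)"
    using off by (subst sum.remove[OF fin \<open>j \<in> B\<close>]) simp
  finally show ?thesis .
qed

text \<open>
  Read the condition on \<open>i\<close>, \<open>j\<close> as absence of an arrow from \<open>i\<close> to \<open>j\<close>, where an arrow means that \<open>j\<close>
  occurs in the square of \<open>i\<close>. Nilpotency forbids a subset of the basis in which every vector has a
  predecessor, in particular loops and cycles: along arrows the squares would sink through all
  powers of the algebra and hence vanish.
\<close>

lemma nilpotent_basis_source:
  assumes alg: "nonassoc_algebra s m" and B: "natural_basis s m B"
    and nil: "nilpotent_algebra s m" and S: "S \<subseteq> B" "S \<noteq> {}"
  shows "\<exists>j\<in>S. \<forall>i\<in>S. module.representation s B (m i i) j = 0"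
proof (rule ccontr)
  interpret vector_space s using alg by (simp add: nonassoc_algebra_def)
  assume "\<not> ?thesis"
  then have pred: "\<exists>i\<in>S. representation B (m i i) j \<noteq> 0" if "j \<in> S" for j using that by blast
  have power: "\<forall>j\<in>S. m j j \<in> principal_power s m (Suc k)" for k
  proof (induction k)
    case (Suc k)
    show ?case
    proof
      fix j assume "j \<in> S"
      then obtain i where "i \<in> S" and i: "representation B (m i i) j \<noteq> 0" using pred by blast
      let ?r = "representation B (m i i) j"
      have "m (m i i) j \<in> principal_power s m (Suc (Suc k))"
        using Suc \<open>i \<in> S\<close> by (auto intro: span_base)
      then have "s (1 / ?r) (m (m i i) j) \<in> principal_power s m (Suc (Suc k))"
        by (simp add: span_scale)
      also have "s (1 / ?r) (m (m i i) j) = m j j"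
        using natural_basis_mult_right[OF alg B, of j "m i i"] S \<open>j \<in> S\<close> i by auto
      finally show "m j j \<in> principal_power s m (Suc (Suc k))" .
    qed
  qed simp
  \<comment> \<open>Evaluated at a power that is zero, this kills all squares, but a predecessor has a nonzero one.\<close>
  obtain n where "n \<ge> 1" "principal_power s m n = {0}"
    using nil by (auto simp: nilpotent_algebra_def)
  then have "m j j = 0" if "j \<in> S" for j using power[of "n - 1"] that by auto
  moreover obtain i j where "i \<in> S" "representation B (m i i) j \<noteq> 0" using pred S by blast
  ultimately show False by (simp add: representation_zero)
qed

text \<open>
  Take a source \<open>u\<close> of the whole basis and a source \<open>v\<close> of the rest; the last vector \<open>w\<close> is a source of
  itself, so it does not occur in its own square. In the order \<open>u\<close>, \<open>v\<close>, \<open>w\<close>, these choices kill the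
  coordinates of the squares on and below the diagonal.
\<close>

lemma nilpotent_evolution_isomorphic_triangular:
  fixes s :: "'f::field \<Rightarrow> 'v::ab_group_add \<Rightarrow> 'v"
  assumes evol: "evolution_algebra s m" and dim: "vector_space.dim s UNIV = 3"
    and nil: "nilpotent_algebra s m"
  shows "\<exists>a b c. isomorphic_algebras (*s) (triangular_mult a b c) s m"
proof -
  have alg: "nonassoc_algebra s m" using evol by (simp add: evolution_algebra_def)
  interpret vector_space s using alg by (simp add: nonassoc_algebra_def)
  obtain B where B: "natural_basis s m B" using evol by (auto simp: evolution_algebra_def)
  have fin: "finite B" and ind: "independent B" and sp: "span B = UNIV"
    and off: "\<And>b c. b \<in> B \<Longrightarrow> c \<in> B \<Longrightarrow> b \<noteq> c \<Longrightarrow> m b c = 0"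
    using B by (auto simp: natural_basis_def)
  have card: "card B = 3"
    using dim basis_card_eq_dim[of B UNIV] ind sp by simp
  note source = nilpotent_basis_source[OF alg B nil]
  obtain u where u: "u \<in> B" "\<forall>i\<in>B. representation B (m i i) u = 0"
    using source[of B] card by fastforce
  have card_u: "card (B - {u}) = 2" using u card by simp
  then obtain v where v: "v \<in> B - {u}" "\<forall>i\<in>B - {u}. representation B (m i i) v = 0"
    using source[of "B - {u}"] by fastforce
  have "card (B - {u} - {v}) = 1" using v card_u by simp
  then obtain w where "B - {u} - {v} = {w}" using card_1_singletonE by blast
  then have Beq: "B = {u, v, w}" and dist: "u \<noteq> v" "u \<noteq> w" "v \<noteq> w" using u v by auto
  have w: "representation B (m w w) w = 0"
    using source[of "{w}"] Beq by auto
  have expand: "s (representation B x u) u + s (representation B x v) v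
      + s (representation B x w) w = x" for x
    using sum_representation_eq[OF ind, of x B] sp Beq dist by (simp add: add.assoc)
  let ?a = "representation B (m u u) v" and ?b = "representation B (m u u) w"
    and ?c = "representation B (m v v) w"
  have repr: "representation B (s p u + s q v + s r w) u = p"
    "representation B (s p u + s q v + s r w) v = q"
    "representation B (s p u + s q v + s r w) w = r" for p q r
    using ind sp Beq dist by (auto simp: representation_add representation_scale representation_basis)
  let ?\<phi> = "\<lambda>x :: 'f ^ 3. s (x $ 1) u + s (x $ 2) v + s (x $ 3) w"
  have "bij ?\<phi>"
  proof (rule bijI')
    show "(?\<phi> x = ?\<phi> y) = (x = y)" for x y
      by (metis repr vec3_eq_iff)
    show "\<exists>x. y = ?\<phi> x" for y
      by (rule exI[of _ "vector [representation B y u, representation B y v, representation B y w]"])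
        (simp add: expand)
  qed
  then have "isomorphic_algebras (*s) (triangular_mult ?a ?b ?c) s m"
  proof (rule isomorphic_triangularI[OF alg])
    show "m u u = s ?a v + s ?b w" using expand[of "m u u"] u by simp
    show "m v v = s ?c w" using expand[of "m v v"] u v by simp
    show "m w w = 0" using expand[of "m w w"] u v w Beq dist by simp
  qed (use off Beq dist in auto)
  then show ?thesis by blast
qed

section \<open>Invariants separating the normal forms\<close>

lemma annihilator_triangular:
  "annihilator (triangular_mult a b c) =
    {x. a * x $ 1 = 0 \<and> b * x $ 1 = 0 \<and> c * x $ 2 = 0}" (is "?A = ?S")
proof
  show "?S \<subseteq> ?A"
    by (auto simp: annihilator_def vec3_eq_iff triangular_mult_coordinates mult.assoc[symmetric])
  show "?A \<subseteq> ?S"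
  proof
    fix x assume "x \<in> ?A"
    then have "triangular_mult a b c x e\<^sub>1 = 0" "triangular_mult a b c x e\<^sub>2 = 0"
      by (simp_all add: annihilator_def)
    then show "x \<in> ?S" by (simp add: vec3_eq_iff triangular_mult_coordinates axis3_coordinates)
  qed
qed

lemma span_axes_23: "vec.span {e\<^sub>2, e\<^sub>3 :: 'f::field ^ 3} = {x. x $ 1 = 0}"
proof
  have "vec.subspace {x :: 'f ^ 3. x $ 1 = 0}" by (auto simp: vec.subspace_def)
  then show "vec.span {e\<^sub>2, e\<^sub>3} \<subseteq> {x :: 'f ^ 3. x $ 1 = 0}"
    by (intro vec.span_minimal) (auto simp: axis3_coordinates)
  show "{x :: 'f ^ 3. x $ 1 = 0} \<subseteq> vec.span {e\<^sub>2, e\<^sub>3}"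
  proof
    fix x :: "'f ^ 3" assume "x \<in> {x. x $ 1 = 0}"
    then have x: "x = x $ 2 *s e\<^sub>2 + x $ 3 *s e\<^sub>3" by (simp add: vec3_eq_iff axis3_coordinates)
    show "x \<in> vec.span {e\<^sub>2, e\<^sub>3}"
      by (subst x) (intro vec.span_add vec.span_scale vec.span_base; simp)
  qed
qed

lemma span_axis_3: "vec.span {e\<^sub>3 :: 'f::field ^ 3} = {x. x $ 1 = 0 \<and> x $ 2 = 0}"
  by (auto simp: vec.span_singleton image_iff vec3_eq_iff axis3_coordinates)

text \<open>
  In \<open>E33 \<alpha>\<close> the second coordinate is killed only because \<open>\<alpha>\<close> is nonzero; for \<open>\<alpha> = 0\<close> the algebra
  would degenerate to a copy of \<open>E32\<close>.
\<close>

lemma annihilators: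
  "annihilator (E31 :: 'f::field ^ 3 \<Rightarrow> _) = UNIV"
  "annihilator (E32 :: 'f::field ^ 3 \<Rightarrow> _) = vec.span {e\<^sub>2, e\<^sub>3}"
  "\<alpha> \<noteq> 0 \<Longrightarrow> annihilator (E33 \<alpha>) = vec.span {e\<^sub>3}"
  "annihilator (E34 :: 'f::field ^ 3 \<Rightarrow> _) = vec.span {e\<^sub>3}"
  by (auto simp: E_eq_triangular annihilator_triangular span_axes_23 span_axis_3)

lemma algebra_iso_annihilator:
  assumes "algebra_iso s m s' m' \<phi>"
  shows "\<phi> ` annihilator m = annihilator m'"
proof -
  have lin: "Vector_Spaces.linear s s' \<phi>" and "bij \<phi>"
    and mult: "\<And>x y. \<phi> (m x y) = m' (\<phi> x) (\<phi> y)"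
    using assms by (auto simp: algebra_iso_def)
  have zero: "\<phi> x = 0 \<longleftrightarrow> x = 0" for x
  proof -
    interpret Vector_Spaces.linear s s' \<phi> by (rule lin)
    show ?thesis using \<open>bij \<phi>\<close> zero by (metis bij_is_inj injD)
  qed
  have "(\<forall>y. m' (\<phi> x) y = 0) \<longleftrightarrow> (\<forall>y. m x y = 0)" for x
    using \<open>bij \<phi>\<close> by (metis bij_pointE mult zero)
  then show ?thesis
    using \<open>bij \<phi>\<close> by (auto simp: annihilator_def image_iff) (metis bij_pointE)
qed

lemma isomorphic_algebras_dim_annihilator:
  fixes m m' :: "'f::field ^ 3 \<Rightarrow> 'f ^ 3 \<Rightarrow> 'f ^ 3"
  assumes "isomorphic_algebras (*s) m (*s) m'"
  shows "vec.dim (annihilator m) = vec.dim (annihilator m')"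
proof -
  obtain \<phi> where \<phi>: "algebra_iso (*s) m (*s) m' \<phi>"
    using assms by (auto simp: isomorphic_algebras_def)
  then have "Vector_Spaces.linear (*s) (*s) \<phi>" "inj \<phi>"
    by (auto simp: algebra_iso_def bij_is_inj)
  then have "vec.dim (\<phi> ` annihilator m) = vec.dim (annihilator m)"
    by (intro vec.dim_image_eq) (auto intro: inj_on_subset)
  then show ?thesis using algebra_iso_annihilator[OF \<phi>] by simp
qed

lemma dim_annihilators:
  "vec.dim (annihilator (E31 :: 'f::field ^ 3 \<Rightarrow> _)) = 3"
  "vec.dim (annihilator (E32 :: 'f::field ^ 3 \<Rightarrow> _)) = 2"
  "\<alpha> \<noteq> 0 \<Longrightarrow> vec.dim (annihilator (E33 (\<alpha>::'f))) = 1"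
  "vec.dim (annihilator (E34 :: 'f::field ^ 3 \<Rightarrow> _)) = 1"
proof -
  have "vec.independent {e\<^sub>2, e\<^sub>3 :: 'f ^ 3}"
    using independent_std_basis by (rule vec.independent_mono) (auto simp: std_basis_def)
  then have "vec.dim {e\<^sub>2, e\<^sub>3 :: 'f ^ 3} = 2"
    by (subst vec.dim_eq_card_independent) (auto simp: axis_eq_axis)
  then show "vec.dim (annihilator (E32 :: 'f ^ 3 \<Rightarrow> _)) = 2"
    by (simp add: annihilators)
  have "vec.dim {e\<^sub>3 :: 'f ^ 3} = 1" by (simp add: vec.dim_singleton)
  then show "vec.dim (annihilator (E34 :: 'f ^ 3 \<Rightarrow> _)) = 1"
    "\<alpha> \<noteq> 0 \<Longrightarrow> vec.dim (annihilator (E33 (\<alpha>::'f))) = 1"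
    by (simp_all add: annihilators)
  show "vec.dim (annihilator (E31 :: 'f ^ 3 \<Rightarrow> _)) = 3"
    unfolding annihilators by (rule dim_vec3)
qed

text \<open>
  For nonzero \<open>\<alpha>\<close> the annihilators have equal dimension, so they do not help. The separating identity is \<open>(x x) y = 0\<close>, which holds
  in \<open>E33 \<alpha>\<close> since squares lie in the annihilator, whereas \<open>(e\<^sub>1 e\<^sub>1) e\<^sub>2 = e\<^sub>3\<close> in \<open>E34\<close>.
\<close>

lemma E33_not_isomorphic_E34:
  "\<not> isomorphic_algebras (*s) (E33 \<alpha>) (*s) (E34 :: 'f::field ^ 3 \<Rightarrow> _)"
proof
  assume "isomorphic_algebras (*s) (E33 \<alpha>) (*s) (E34 :: 'f::field ^ 3 \<Rightarrow> _)"
  then obtain \<phi> where lin: "Vector_Spaces.linear (*s) (*s) \<phi>" and "bij \<phi>"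
    and mult: "\<And>x y. \<phi> (E33 \<alpha> x y) = E34 (\<phi> x) (\<phi> y)"
    by (auto simp: isomorphic_algebras_def algebra_iso_def)
  interpret Vector_Spaces.linear "(*s)" "(*s)" \<phi> by (rule lin)
  obtain x y where xy: "\<phi> x = e\<^sub>1" "\<phi> y = e\<^sub>2" using \<open>bij \<phi>\<close> by (metis bij_pointE)
  have "E34 (E34 (\<phi> x) (\<phi> x)) (\<phi> y) = \<phi> (E33 \<alpha> (E33 \<alpha> x x) y)"
    by (simp add: mult)
  also have "E33 \<alpha> (E33 \<alpha> x x) y = 0"
    by (simp add: E_eq_triangular vec3_eq_iff triangular_mult_coordinates)
  finally have "E34 (E34 e\<^sub>1 e\<^sub>1) e\<^sub>2 = (0 :: 'f ^ 3)" by (simp add: xy zero)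
  then show False
    by (simp add: E_eq_triangular triangular_mult_basis vec3_eq_iff axis3_coordinates)
qed

text \<open>
  On the first two coordinates, an isomorphism transports the form \<open>x\<^sub>1 y\<^sub>1 + \<beta> x\<^sub>2 y\<^sub>2\<close> to a multiple of
  \<open>x\<^sub>1 y\<^sub>1 + \<alpha> x\<^sub>2 y\<^sub>2\<close>. Comparing Gram determinants gives \<open>\<beta> d\<^sup>2 = \<alpha> w\<^sub>3\<^sup>2\<close>, where \<open>d\<close> is the determinant
  of the upper left block and \<open>w\<^sub>3\<close> the scaling factor.
\<close>

lemma E33_isomorphic_imp_same_square_class:
  assumes "isomorphic_algebras (*s) (E33 \<alpha>) (*s) (E33 \<beta>)" and "\<alpha> \<noteq> 0"
  shows "\<exists>t. t \<noteq> 0 \<and> \<alpha> = \<beta> * t\<^sup>2"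
proof -
  obtain \<phi> where lin: "Vector_Spaces.linear (*s) (*s) \<phi>" and "bij \<phi>"
    and mult: "\<forall>x y. \<phi> (E33 \<alpha> x y) = E33 \<beta> (\<phi> x) (\<phi> y)"
    using assms by (auto simp: isomorphic_algebras_def algebra_iso_def)
  interpret Vector_Spaces.linear "(*s)" "(*s)" \<phi> by (rule lin)
  define u v w where "u = \<phi> e\<^sub>1" and "v = \<phi> e\<^sub>2" and "w = \<phi> e\<^sub>3"
  have "w \<noteq> 0"
    using \<open>bij \<phi>\<close> zero injD[OF bij_is_inj, of \<phi> "e\<^sub>3" 0] by (auto simp: w_def axis_eq_0_iff)
  have rel: "triangular_mult 0 1 \<beta> u u = w" "triangular_mult 0 1 \<beta> v v = \<alpha> *s w"
    "triangular_mult 0 1 \<beta> u v = 0"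
    using mult unfolding E_eq_triangular triangular_hom_iff[OF nonassoc_algebra_triangular lin]
    by (auto simp: u_def v_def w_def)
  then have "w $ 1 = 0" "w $ 2 = 0" and *: "w $ 3 = u $ 1 * u $ 1 + \<beta> * (u $ 2 * u $ 2)"
    "\<alpha> * w $ 3 = v $ 1 * v $ 1 + \<beta> * (v $ 2 * v $ 2)" "u $ 1 * v $ 1 + \<beta> * (u $ 2 * v $ 2) = 0"
    by (auto simp: vec3_eq_iff triangular_mult_coordinates)
  then have w3: "w $ 3 \<noteq> 0" using \<open>w \<noteq> 0\<close> by (simp add: vec3_eq_iff)
  define d where "d = u $ 1 * v $ 2 - u $ 2 * v $ 1"
  \<comment> \<open>Brahmagupta's identity\<close>
  have "(u $ 1 * u $ 1 + \<beta> * (u $ 2 * u $ 2)) * (v $ 1 * v $ 1 + \<beta> * (v $ 2 * v $ 2)) =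
      (u $ 1 * v $ 1 + \<beta> * (u $ 2 * v $ 2))\<^sup>2 + \<beta> * d\<^sup>2"
    unfolding d_def by (simp add: power2_eq_square algebra_simps)
  then have d: "\<alpha> * (w $ 3)\<^sup>2 = \<beta> * d\<^sup>2"
    by (simp only: *(3) flip: *(1) *(2)) (simp add: power2_eq_square mult_ac)
  then have "\<alpha> = \<beta> * (d / w $ 3)\<^sup>2" using w3 by (simp add: field_simps)
  moreover have "d / w $ 3 \<noteq> 0" using d w3 \<open>\<alpha> \<noteq> 0\<close> by auto
  ultimately show ?thesis by blast
qed

section \<open>Automorphism groups\<close>

lemma algebra_Aut_triangular_iff:
  fixes \<phi> :: "'f::field ^ 3 \<Rightarrow> 'f ^ 3"
  shows "\<phi> \<in> algebra_Aut (*s) (triangular_mult a b c) \<longleftrightarrow> \<phi> \<in> general_linear (*s) \<and>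
    triangular_mult a b c (\<phi> e\<^sub>1) (\<phi> e\<^sub>1) = a *s \<phi> e\<^sub>2 + b *s \<phi> e\<^sub>3 \<and>
    triangular_mult a b c (\<phi> e\<^sub>2) (\<phi> e\<^sub>2) = c *s \<phi> e\<^sub>3 \<and>
    triangular_mult a b c (\<phi> e\<^sub>3) (\<phi> e\<^sub>3) = 0 \<and>
    triangular_mult a b c (\<phi> e\<^sub>1) (\<phi> e\<^sub>2) = 0 \<and>
    triangular_mult a b c (\<phi> e\<^sub>1) (\<phi> e\<^sub>3) = 0 \<and>
    triangular_mult a b c (\<phi> e\<^sub>2) (\<phi> e\<^sub>3) = 0"
    (is "_ \<longleftrightarrow> _ \<and> ?relations")
proof (cases "\<phi> \<in> general_linear (*s)")
  case True
  then have lin: "Vector_Spaces.linear (*s) (*s) \<phi>" by (simp add: general_linear_def)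
  have "(\<forall>x y. \<phi> (triangular_mult a b c x y) = triangular_mult a b c (\<phi> x) (\<phi> y)) \<longleftrightarrow> ?relations"
    unfolding triangular_hom_iff[OF nonassoc_algebra_triangular lin] forall_3
    using triangular_mult_commute[of a b c] by auto
  then show ?thesis
    using True by (auto simp: algebra_Aut_def algebra_iso_def general_linear_def)
qed (auto simp: algebra_Aut_def algebra_iso_def general_linear_def)

lemma matrix_entry: "matrix \<phi> $ i $ j = \<phi> (axis j 1) $ i"
  by (simp add: matrix_def)

lemma general_linear_axis_nonzero:
  assumes "\<phi> \<in> general_linear (*s)"
  shows "\<phi> (axis i 1 :: 'f::field ^ 3) \<noteq> 0"
proof -
  have lin: "Vector_Spaces.linear (*s) (*s) \<phi>" and "inj \<phi>"
    using assms by (auto simp: general_linear_def bij_is_inj)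
  interpret Vector_Spaces.linear "(*s)" "(*s)" \<phi> by (rule lin)
  show ?thesis using injD[OF \<open>inj \<phi>\<close>, of "axis i 1" 0] zero by (auto simp: axis_eq_0_iff)
qed

lemma algebra_Aut_E31: "algebra_Aut (*s) (E31 :: 'f::field ^ 3 \<Rightarrow> _) = general_linear (*s)"
  by (auto simp: E_eq_triangular algebra_Aut_triangular_iff vec3_eq_iff triangular_mult_coordinates)

text \<open>
  Here \<open>u\<close>, \<open>v\<close>, \<open>w\<close> are the columns. From \<open>v = u\<^sub>1\<^sup>2 e\<^sub>2 \<noteq> 0\<close> the entry \<open>u\<^sub>1\<close> is nonzero, so \<open>u w = 0\<close> forces \<open>w\<^sub>1 = 0\<close>.
\<close>

lemma algebra_Aut_E32:
  "algebra_Aut (*s) (E32 :: 'f::field ^ 3 \<Rightarrow> _) =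
    {\<phi>. \<phi> \<in> general_linear (*s) \<and>
         (\<exists>a11 a21 a23 a31 a33. matrix \<phi> =
            vector [vector [a11, 0, 0],
                    vector [a21, a11\<^sup>2, a23],
                    vector [a31, 0, a33]])}"
    (is "_ = {\<phi>. _ \<and> ?shape \<phi>}")
proof -
  have "\<phi> \<in> algebra_Aut (*s) E32 \<longleftrightarrow> \<phi> \<in> general_linear (*s) \<and> ?shape \<phi>"
    for \<phi> :: "'f ^ 3 \<Rightarrow> 'f ^ 3"
  proof (cases "\<phi> \<in> general_linear (*s)")
    case True
    let ?u = "\<phi> e\<^sub>1" and ?v = "\<phi> e\<^sub>2" and ?w = "\<phi> e\<^sub>3"
    have "?v \<noteq> 0" using True by (rule general_linear_axis_nonzero)
    have "\<phi> \<in> algebra_Aut (*s) E32 \<longleftrightarrow>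
        ?v $ 1 = 0 \<and> ?v $ 2 = (?u $ 1)\<^sup>2 \<and> ?v $ 3 = 0 \<and> ?w $ 1 = 0"
      using True \<open>?v \<noteq> 0\<close>
      by (auto simp: E_eq_triangular algebra_Aut_triangular_iff vec3_eq_iff
          triangular_mult_coordinates power2_eq_square)
    also have "\<dots> \<longleftrightarrow> ?shape \<phi>"
      by (auto simp: vec3_eq_iff matrix_entry)
    finally show ?thesis using True by simp
  qed (auto simp: algebra_Aut_def algebra_iso_def general_linear_def)
  then show ?thesis by blast
qed

text \<open>
  The square of the first column is the third column, which therefore lies in the annihilator; the
  three equations say that \<open>e\<^sub>1\<^sup>2\<close>, \<open>e\<^sub>2\<^sup>2\<close> and \<open>e\<^sub>1 e\<^sub>2\<close> are respected.
\<close>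

lemma algebra_Aut_E33:
  "algebra_Aut (*s) (E33 \<alpha>) =
    {\<phi> :: 'f::field ^ 3 \<Rightarrow> 'f ^ 3. \<phi> \<in> general_linear (*s) \<and>
         (\<exists>a11 a12 a21 a22 a31 a32 a33. matrix \<phi> =
            vector [vector [a11, a12, 0],
                    vector [a21, a22, 0],
                    vector [a31, a32, a33]] \<and>
            a11\<^sup>2 + \<alpha> * a21\<^sup>2 = a33 \<and>
            a12\<^sup>2 + \<alpha> * a22\<^sup>2 = \<alpha> * a33 \<and>
            a11 * a12 + \<alpha> * a21 * a22 = 0)}"
    (is "_ = {\<phi>. _ \<and> ?shape \<phi>}")
proof -
  have "\<phi> \<in> algebra_Aut (*s) (E33 \<alpha>) \<longleftrightarrow> \<phi> \<in> general_linear (*s) \<and> ?shape \<phi>"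
    for \<phi> :: "'f ^ 3 \<Rightarrow> 'f ^ 3"
  proof (cases "\<phi> \<in> general_linear (*s)")
    case True
    let ?u = "\<phi> e\<^sub>1" and ?v = "\<phi> e\<^sub>2" and ?w = "\<phi> e\<^sub>3"
    have "\<phi> \<in> algebra_Aut (*s) (E33 \<alpha>) \<longleftrightarrow>
        ?w $ 1 = 0 \<and> ?w $ 2 = 0 \<and> (?u $ 1)\<^sup>2 + \<alpha> * (?u $ 2)\<^sup>2 = ?w $ 3 \<and>
        (?v $ 1)\<^sup>2 + \<alpha> * (?v $ 2)\<^sup>2 = \<alpha> * ?w $ 3 \<and> ?u $ 1 * ?v $ 1 + \<alpha> * ?u $ 2 * ?v $ 2 = 0"
      using True
      by (auto simp: E_eq_triangular algebra_Aut_triangular_iff vec3_eq_iff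
          triangular_mult_coordinates power2_eq_square mult.assoc)
    also have "\<dots> \<longleftrightarrow> ?shape \<phi>"
      by (auto simp: vec3_eq_iff matrix_entry)
    finally show ?thesis using True by simp
  qed (auto simp: algebra_Aut_def algebra_iso_def general_linear_def)
  then show ?thesis by blast
qed

text \<open>
  The second column is the square \<open>(0, u\<^sub>1\<^sup>2, u\<^sub>2\<^sup>2)\<close> of the first and the third is the square
  \<open>(0, 0, u\<^sub>1\<^sup>4)\<close> of the second. The third is nonzero, hence so is \<open>u\<^sub>1\<close>, and the vanishing of the product of
  the first two, \<open>u\<^sub>2 u\<^sub>1\<^sup>2 e\<^sub>3\<close>, leaves \<open>u\<^sub>2 = 0\<close>.
\<close>

lemma algebra_Aut_E34:
  "algebra_Aut (*s) (E34 :: 'f::field ^ 3 \<Rightarrow> _) =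
    {\<phi>. \<phi> \<in> general_linear (*s) \<and>
         (\<exists>a11 a31. matrix \<phi> =
            vector [vector [a11, 0, 0],
                    vector [0, a11\<^sup>2, 0],
                    vector [a31, 0, a11 ^ 4]])}"
    (is "_ = {\<phi>. _ \<and> ?shape \<phi>}")
proof -
  have "\<phi> \<in> algebra_Aut (*s) E34 \<longleftrightarrow> \<phi> \<in> general_linear (*s) \<and> ?shape \<phi>"
    for \<phi> :: "'f ^ 3 \<Rightarrow> 'f ^ 3"
  proof (cases "\<phi> \<in> general_linear (*s)")
    case True
    let ?u = "\<phi> e\<^sub>1" and ?v = "\<phi> e\<^sub>2" and ?w = "\<phi> e\<^sub>3"
    have "?w \<noteq> 0" using True by (rule general_linear_axis_nonzero)
    have "\<phi> \<in> algebra_Aut (*s) E34 \<longleftrightarrow>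
        ?u $ 2 = 0 \<and> ?v $ 1 = 0 \<and> ?v $ 2 = (?u $ 1)\<^sup>2 \<and> ?v $ 3 = 0 \<and>
        ?w $ 1 = 0 \<and> ?w $ 2 = 0 \<and> ?w $ 3 = ((?u $ 1)\<^sup>2)\<^sup>2"
      using True \<open>?w \<noteq> 0\<close>
      by (auto simp: E_eq_triangular algebra_Aut_triangular_iff vec3_eq_iff
          triangular_mult_coordinates power2_eq_square)
    also have "\<dots> \<longleftrightarrow> ?shape \<phi>"
      by (auto simp: vec3_eq_iff matrix_entry simp flip: power_mult)
    finally show ?thesis using True by simp
  qed (auto simp: algebra_Aut_def algebra_iso_def general_linear_def)
  then show ?thesis by blast
qed

section \<open>Diagonal bilinear forms\<close>

interpretation forms: vector_space form_scale
  by (rule vector_space_form_scale)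

lemma (in module) span_pair: "span {x, y} = {scale k x + scale l y | k l. True}"
proof -
  have "z \<in> span {x, y} \<longleftrightarrow> (\<exists>k l. z = scale k x + scale l y)" for z
    by (simp add: span_insert[of x] span_singleton image_iff diff_eq_eq add.commute)
  then show ?thesis by blast
qed

lemma delta_form_std_basis:
  "delta_form (*s) std_basis (axis i 1) (axis j 1) x y = x $ i * (y :: 'f::field ^ 3) $ j"
  by (simp add: delta_form_def representation_std_basis)

text \<open>
  A functional with values \<open>k\<close> and \<open>l\<close> at \<open>e\<^sub>2\<close> and \<open>e\<^sub>3\<close> turns the product into \<open>k\<close> times its second
  coordinate form plus \<open>l\<close> times its third; the first coordinate of a product is zero.
\<close>

lemma B_forms_triangular:
  "B_forms (*s) (triangular_mult a b c) =
    forms.span {form_scale a \<delta>\<^sub>1, form_scale b \<delta>\<^sub>1 + form_scale c (\<delta>\<^sub>2 :: 'f::field ^ 3 \<Rightarrow> _)}"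
    (is "_ = forms.span {?p, ?q}")
proof
  show "B_forms (*s) (triangular_mult a b c) \<subseteq> forms.span {?p, ?q}"
  proof
    fix \<theta> assume "\<theta> \<in> B_forms (*s) (triangular_mult a b c)"
    then obtain f where f: "Vector_Spaces.linear (*s) (*) f"
      and \<theta>: "\<theta> = (\<lambda>x y. f (triangular_mult a b c x y))"
      by (auto simp: B_forms_def)
    have "\<theta> = form_scale (f e\<^sub>2) ?p + form_scale (f e\<^sub>3) ?q"
      unfolding \<theta> by (simp add: linear_vec3_expand[OF f, of "triangular_mult a b c _ _"] fun_eq_iff
          triangular_mult_coordinates form_scale_def delta_form_std_basis algebra_simps)
    then show "\<theta> \<in> forms.span {?p, ?q}" by (auto simp: forms.span_pair)
  qed
  show "forms.span {?p, ?q} \<subseteq> B_forms (*s) (triangular_mult a b c)"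
  proof
    fix \<theta> assume "\<theta> \<in> forms.span {?p, ?q}"
    then obtain k l where \<theta>: "\<theta> = form_scale k ?p + form_scale l ?q"
      by (auto simp: forms.span_pair)
    have field: "vector_space ((*) :: 'f \<Rightarrow> 'f \<Rightarrow> 'f)" by unfold_locales (auto simp: algebra_simps)
    have "Vector_Spaces.linear (*s) (*) (\<lambda>x :: 'f ^ 3. k * x $ 2 + l * x $ 3)"
      by (auto simp: Vector_Spaces.linear_iff vec.vector_space_axioms field algebra_simps)
    then show "\<theta> \<in> B_forms (*s) (triangular_mult a b c)"
      unfolding B_forms_def \<theta>
      by (intro CollectI exI[of _ "\<lambda>x. k * x $ 2 + l * x $ 3"] conjI)
        (simp_all add: fun_eq_iff triangular_mult_coordinates form_scale_def delta_form_std_basis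
          algebra_simps)
  qed
qed

lemma B_forms_normal_forms:
  "B_forms (*s) (E31 :: 'f::field ^ 3 \<Rightarrow> _) = {0}"
  "B_forms (*s) (E32 :: 'f ^ 3 \<Rightarrow> _) = forms.span {\<delta>\<^sub>1}"
  "B_forms (*s) (E33 (\<alpha> :: 'f)) = forms.span {\<delta>\<^sub>1 + form_scale \<alpha> \<delta>\<^sub>2}"
  "B_forms (*s) (E34 :: 'f ^ 3 \<Rightarrow> _) = forms.span {\<delta>\<^sub>1, \<delta>\<^sub>2}"
  by (simp_all only: E_eq_triangular B_forms_triangular forms.scale_zero_left forms.scale_one
      add_0_left add_0_right forms.span_insert_0 forms.span_empty insert_commute[of "\<delta>\<^sub>1" 0])

lemma Z_forms_std_basis: "Z_forms (*s) std_basis = forms.span {\<delta>\<^sub>1, \<delta>\<^sub>2, \<delta>\<^sub>3 :: 'f::field ^ 3 \<Rightarrow> _}"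
proof
  show "Z_forms (*s) std_basis \<subseteq> forms.span {\<delta>\<^sub>1, \<delta>\<^sub>2, \<delta>\<^sub>3 :: 'f ^ 3 \<Rightarrow> _}"
  proof
    fix \<theta> :: "'f ^ 3 \<Rightarrow> 'f ^ 3 \<Rightarrow> 'f" assume \<theta>: "\<theta> \<in> Z_forms (*s) std_basis"
    then have left: "Vector_Spaces.linear (*s) (*) (\<lambda>x. \<theta> x y)"
      and right: "Vector_Spaces.linear (*s) (*) (\<lambda>y. \<theta> x y)" for x y
      by (auto simp: Z_forms_def bilinear_map_def)
    have off: "\<theta> (axis i 1) (axis j 1) = 0" if "i \<noteq> j" for i j :: 3
      using \<theta> that exhaust_3[of i] exhaust_3[of j] by (auto simp: Z_forms_def std_basis_def axis_eq_axis)
    have "\<theta> = form_scale (\<theta> e\<^sub>1 e\<^sub>1) \<delta>\<^sub>1 + form_scale (\<theta> e\<^sub>2 e\<^sub>2) \<delta>\<^sub>2 + form_scale (\<theta> e\<^sub>3 e\<^sub>3) \<delta>\<^sub>3"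
    proof (intro ext)
      fix x y
      show "\<theta> x y = (form_scale (\<theta> e\<^sub>1 e\<^sub>1) \<delta>\<^sub>1 + form_scale (\<theta> e\<^sub>2 e\<^sub>2) \<delta>\<^sub>2
          + form_scale (\<theta> e\<^sub>3 e\<^sub>3) \<delta>\<^sub>3) x y"
        by (simp add: linear_vec3_expand[OF left, of x] linear_vec3_expand[OF right, of _ y] off
            form_scale_def delta_form_std_basis algebra_simps)
    qed
    also have "\<dots> \<in> forms.span {\<delta>\<^sub>1, \<delta>\<^sub>2, \<delta>\<^sub>3}"
      by (intro forms.span_add forms.span_scale forms.span_base) auto
    finally show "\<theta> \<in> forms.span {\<delta>\<^sub>1, \<delta>\<^sub>2, \<delta>\<^sub>3}" .
  qed
  have "forms.subspace (Z_forms (*s) std_basis :: ('f ^ 3 \<Rightarrow> 'f ^ 3 \<Rightarrow> 'f) set)"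
    by (auto simp: forms.subspace_def Z_forms_def bilinear_map_def Vector_Spaces.linear_iff
        form_scale_def algebra_simps vec.vector_space_axioms)
      (unfold_locales; simp add: algebra_simps)+
  moreover have "delta_form (*s) std_basis b b \<in> Z_forms (*s) std_basis" for b :: "'f ^ 3"
    by (auto simp: Z_forms_def bilinear_delta_form delta_form_basis vec.vector_space_axioms
        independent_std_basis span_std_basis)
  ultimately show "forms.span {\<delta>\<^sub>1, \<delta>\<^sub>2, \<delta>\<^sub>3 :: 'f ^ 3 \<Rightarrow> _} \<subseteq> Z_forms (*s) std_basis"
    by (intro forms.span_minimal) auto
qed

section \<open>Spans in a quotient space\<close>

text \<open>
  The quotient map is linear, so it commutes with taking spans. The inclusion of the right side in
  any subspace containing the cosets of \<open>S\<close> is an induction along linear combinations.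
\<close>

lemma quotient_span_cosets:
  assumes vs: "vector_space s" and W: "module.subspace s W"
  shows "quotient_span s W ((\<lambda>x. x +o W) ` S) = (\<lambda>x. x +o W) ` module.span s S"
proof -
  interpret vector_space s by (rule vs)
  note add = quotient_plus_coset[OF vs W] and scale = quotient_scale_coset[OF vs W]
  show ?thesis
    unfolding quotient_span_def
  proof (rule hull_unique)
    show "(\<lambda>x. x +o W) ` S \<subseteq> (\<lambda>x. x +o W) ` span S"
      by (intro image_mono span_superset)
    have "W \<in> (\<lambda>x. x +o W) ` span S"
      by (rule image_eqI[of _ _ 0]) (simp_all add: span_zero)
    then show "quotient_subspace s W ((\<lambda>x. x +o W) ` span S)"
      by (auto simp: quotient_subspace_def add scale intro!: imageI span_add span_scale)
  next
    fix T assume S: "(\<lambda>x. x +o W) ` S \<subseteq> T" and T: "quotient_subspace s W T"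
    have "x +o W \<in> T" if "x \<in> span S" for x
      using that
    proof (induction rule: span_induct_alt)
      case base
      show ?case using T by (simp add: quotient_subspace_def)
    next
      case (step c x y)
      have "quotient_scale s W c (x +o W) + (y +o W) \<in> T"
        using step S T by (auto simp: quotient_subspace_def)
      then show ?case by (simp add: add scale)
    qed
    then show "(\<lambda>x. x +o W) ` span S \<subseteq> T" by blast
  qed
qed

text \<open>
  Generators that already lie in the subspace divided out may be dropped from a spanning set of the
  whole space.
\<close>

lemma H_forms_eq_H_span:
  fixes s :: "'f::field \<Rightarrow> 'v::ab_group_add \<Rightarrow> 'v"
  assumes B: "B_forms s m = forms.span T" and Z: "Z_forms s B = forms.span (S \<union> T)"
  shows "H_forms s m B = H_span s m S"
proof -
  let ?W = "B_forms s m"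
  have W: "forms.subspace ?W" by (simp add: B)
  have "(\<theta> + \<eta>) +o ?W = \<theta> +o ?W" if "\<eta> \<in> ?W" for \<theta> \<eta> :: "'v \<Rightarrow> 'v \<Rightarrow> 'f"
  proof
    show "(\<theta> + \<eta>) +o ?W \<subseteq> \<theta> +o ?W"
      using forms.subspace_add[OF W that] by (auto simp: elt_set_plus_def add.assoc)
    show "\<theta> +o ?W \<subseteq> (\<theta> + \<eta>) +o ?W"
    proof
      fix \<zeta> assume "\<zeta> \<in> \<theta> +o ?W"
      then obtain \<omega> where \<omega>: "\<omega> \<in> ?W" "\<zeta> = \<theta> + \<omega>" by (auto simp: elt_set_plus_def)
      have "\<omega> - \<eta> \<in> ?W" using forms.subspace_diff[OF W \<omega>(1) that] .
      then show "\<zeta> \<in> (\<theta> + \<eta>) +o ?W" unfolding elt_set_plus_def \<omega>(2) by force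
    qed
  qed
  then have "(\<lambda>\<theta>. \<theta> +o ?W) ` Z_forms s B = (\<lambda>\<theta>. \<theta> +o ?W) ` forms.span S"
    unfolding Z forms.span_Un using forms.span_zero[of T] B by (force simp: image_iff)
  then show ?thesis
    by (simp add: H_forms_def H_span_def quotient_span_cosets[OF vector_space_form_scale W])
qed

lemma H_forms_normal_forms:
  "H_forms (*s) (E31 :: 'f::field ^ 3 \<Rightarrow> _) std_basis = H_span (*s) E31 {\<delta>\<^sub>1, \<delta>\<^sub>2, \<delta>\<^sub>3}"
  "H_forms (*s) (E32 :: 'f ^ 3 \<Rightarrow> _) std_basis = H_span (*s) E32 {\<delta>\<^sub>2, \<delta>\<^sub>3}"
  "\<alpha> \<noteq> 0 \<Longrightarrow> H_forms (*s) (E33 (\<alpha> :: 'f)) std_basis = H_span (*s) (E33 \<alpha>) {\<delta>\<^sub>1, \<delta>\<^sub>3}"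
  "H_forms (*s) (E34 :: 'f ^ 3 \<Rightarrow> _) std_basis = H_span (*s) E34 {\<delta>\<^sub>3}"
proof -
  show "H_forms (*s) (E31 :: 'f ^ 3 \<Rightarrow> _) std_basis = H_span (*s) E31 {\<delta>\<^sub>1, \<delta>\<^sub>2, \<delta>\<^sub>3}"
    by (rule H_forms_eq_H_span[where T = "{}"]) (simp_all add: B_forms_normal_forms Z_forms_std_basis)
  show "H_forms (*s) (E32 :: 'f ^ 3 \<Rightarrow> _) std_basis = H_span (*s) E32 {\<delta>\<^sub>2, \<delta>\<^sub>3}"
    by (rule H_forms_eq_H_span[OF B_forms_normal_forms(2)]) (simp add: Z_forms_std_basis insert_commute)
  show "H_forms (*s) (E34 :: 'f ^ 3 \<Rightarrow> _) std_basis = H_span (*s) E34 {\<delta>\<^sub>3}"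
    by (rule H_forms_eq_H_span[OF B_forms_normal_forms(4)]) (simp add: Z_forms_std_basis insert_commute)
  show "H_forms (*s) (E33 \<alpha>) std_basis = H_span (*s) (E33 \<alpha>) {\<delta>\<^sub>1, \<delta>\<^sub>3}" if "\<alpha> \<noteq> 0"
  proof (rule H_forms_eq_H_span[OF B_forms_normal_forms(3)])
    let ?S = "{\<delta>\<^sub>1, \<delta>\<^sub>3} \<union> {\<delta>\<^sub>1 + form_scale \<alpha> \<delta>\<^sub>2 :: 'f ^ 3 \<Rightarrow> _}"
    \<comment> \<open>As \<open>\<alpha>\<close> is invertible, \<open>\<delta>\<^sub>2\<close> can be recovered from the generator of the subspace and \<open>\<delta>\<^sub>1\<close>.\<close>
    have "\<delta>\<^sub>2 = form_scale (1 / \<alpha>) ((\<delta>\<^sub>1 + form_scale \<alpha> \<delta>\<^sub>2) - \<delta>\<^sub>1)"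
      using that by (simp add: form_scale_def fun_eq_iff)
    also have "\<dots> \<in> forms.span ?S"
      by (intro forms.span_scale forms.span_diff forms.span_base) auto
    finally have "\<delta>\<^sub>2 \<in> forms.span ?S" .
    then have "{\<delta>\<^sub>1, \<delta>\<^sub>2, \<delta>\<^sub>3} \<subseteq> forms.span ?S" by (auto intro: forms.span_base)
    moreover have "\<delta>\<^sub>1 + form_scale \<alpha> \<delta>\<^sub>2 \<in> forms.span {\<delta>\<^sub>1, \<delta>\<^sub>2, \<delta>\<^sub>3}"
      by (intro forms.span_add forms.span_scale forms.span_base) auto
    then have "?S \<subseteq> forms.span {\<delta>\<^sub>1, \<delta>\<^sub>2, \<delta>\<^sub>3}" by (auto intro: forms.span_base)
    ultimately show "Z_forms (*s) std_basis = forms.span ?S"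
      unfolding Z_forms_std_basis forms.span_eq by blast
  qed
qed

section \<open>The classification\<close>

theorem theorem18:
  fixes R :: "'f::field set"
  assumes "square_class_representatives R"
  shows
    "(std_nilpotent_evolution (E31 :: 'f ^ 3 \<Rightarrow> _) \<and>
      std_nilpotent_evolution (E32 :: 'f ^ 3 \<Rightarrow> _) \<and>
      (\<forall>\<alpha>\<in>R. std_nilpotent_evolution (E33 \<alpha>)) \<and>
      std_nilpotent_evolution (E34 :: 'f ^ 3 \<Rightarrow> _))
     \<and>
     (\<forall>(s :: 'f \<Rightarrow> 'v::ab_group_add \<Rightarrow> 'v) m.
        evolution_algebra s m \<and> vector_space.dim s UNIV = 3 \<and> nilpotent_algebra s m \<longrightarrow>
          isomorphic_algebras s m (*s) (E31 :: 'f ^ 3 \<Rightarrow> _) \<or>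
          isomorphic_algebras s m (*s) (E32 :: 'f ^ 3 \<Rightarrow> _) \<or>
          (\<exists>\<alpha>\<in>R. isomorphic_algebras s m (*s) (E33 \<alpha>)) \<or>
          isomorphic_algebras s m (*s) (E34 :: 'f ^ 3 \<Rightarrow> _))
     \<and>
     (\<not> isomorphic_algebras (*s) (E31 :: 'f ^ 3 \<Rightarrow> _) (*s) (E32 :: 'f ^ 3 \<Rightarrow> _) \<and>
      (\<forall>\<alpha>\<in>R. \<not> isomorphic_algebras (*s) (E31 :: 'f ^ 3 \<Rightarrow> _) (*s) (E33 \<alpha>)) \<and>
      \<not> isomorphic_algebras (*s) (E31 :: 'f ^ 3 \<Rightarrow> _) (*s) (E34 :: 'f ^ 3 \<Rightarrow> _) \<and>
      (\<forall>\<alpha>\<in>R. \<not> isomorphic_algebras (*s) (E32 :: 'f ^ 3 \<Rightarrow> _) (*s) (E33 \<alpha>)) \<and>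
      \<not> isomorphic_algebras (*s) (E32 :: 'f ^ 3 \<Rightarrow> _) (*s) (E34 :: 'f ^ 3 \<Rightarrow> _) \<and>
      (\<forall>\<alpha>\<in>R. \<not> isomorphic_algebras (*s) (E33 \<alpha>) (*s) (E34 :: 'f ^ 3 \<Rightarrow> _)) \<and>
      (\<forall>\<alpha>\<in>R. \<forall>\<beta>\<in>R. \<alpha> \<noteq> \<beta> \<longrightarrow> \<not> isomorphic_algebras (*s) (E33 \<alpha>) (*s) (E33 \<beta>)))
     \<and>
     (B_forms (*s) (E31 :: 'f ^ 3 \<Rightarrow> _) = {0} \<and>
      H_forms (*s) (E31 :: 'f ^ 3 \<Rightarrow> _) std_basis = H_span (*s) E31 {\<delta>\<^sub>1, \<delta>\<^sub>2, \<delta>\<^sub>3} \<and>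
      annihilator (E31 :: 'f ^ 3 \<Rightarrow> _) = UNIV \<and>
      algebra_Aut (*s) (E31 :: 'f ^ 3 \<Rightarrow> _) = general_linear (*s))
     \<and>
     (B_forms (*s) (E32 :: 'f ^ 3 \<Rightarrow> _) = module.span form_scale {\<delta>\<^sub>1} \<and>
      H_forms (*s) (E32 :: 'f ^ 3 \<Rightarrow> _) std_basis = H_span (*s) E32 {\<delta>\<^sub>2, \<delta>\<^sub>3} \<and>
      annihilator (E32 :: 'f ^ 3 \<Rightarrow> _) = module.span (*s) {e\<^sub>2, e\<^sub>3} \<and>
      algebra_Aut (*s) (E32 :: 'f ^ 3 \<Rightarrow> _) =
        {\<phi>. \<phi> \<in> general_linear (*s) \<and>
             (\<exists>a11 a21 a23 a31 a33. matrix \<phi> =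
                vector [vector [a11, 0, 0],
                        vector [a21, a11\<^sup>2, a23],
                        vector [a31, 0, a33]])})
     \<and>
     (\<forall>\<alpha>\<in>R.
        B_forms (*s) (E33 \<alpha>) = module.span form_scale {\<delta>\<^sub>1 + form_scale \<alpha> \<delta>\<^sub>2} \<and>
        H_forms (*s) (E33 \<alpha>) std_basis = H_span (*s) (E33 \<alpha>) {\<delta>\<^sub>1, \<delta>\<^sub>3} \<and>
        annihilator (E33 \<alpha>) = module.span (*s) {e\<^sub>3} \<and>
        algebra_Aut (*s) (E33 \<alpha>) =
          {\<phi>. \<phi> \<in> general_linear (*s) \<and>
               (\<exists>a11 a12 a21 a22 a31 a32 a33. matrix \<phi> =
                  vector [vector [a11, a12, 0],
                          vector [a21, a22, 0],
                          vector [a31, a32, a33]] \<and>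
                  a11\<^sup>2 + \<alpha> * a21\<^sup>2 = a33 \<and>
                  a12\<^sup>2 + \<alpha> * a22\<^sup>2 = \<alpha> * a33 \<and>
                  a11 * a12 + \<alpha> * a21 * a22 = 0)})
     \<and>
     (B_forms (*s) (E34 :: 'f ^ 3 \<Rightarrow> _) = module.span form_scale {\<delta>\<^sub>1, \<delta>\<^sub>2} \<and>
      H_forms (*s) (E34 :: 'f ^ 3 \<Rightarrow> _) std_basis = H_span (*s) E34 {\<delta>\<^sub>3} \<and>
      annihilator (E34 :: 'f ^ 3 \<Rightarrow> _) = module.span (*s) {e\<^sub>3} \<and>
      algebra_Aut (*s) (E34 :: 'f ^ 3 \<Rightarrow> _) =
        {\<phi>. \<phi> \<in> general_linear (*s) \<and>
             (\<exists>a11 a31. matrix \<phi> =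
                vector [vector [a11, 0, 0],
                        vector [0, a11\<^sup>2, 0],
                        vector [a31, 0, a11 ^ 4]])})"
proof (intro conjI)
  note nonzero = square_class_representative_nonzero[OF assms]
  show "\<forall>(s :: 'f \<Rightarrow> 'v::ab_group_add \<Rightarrow> 'v) m.
        evolution_algebra s m \<and> vector_space.dim s UNIV = 3 \<and> nilpotent_algebra s m \<longrightarrow>
          isomorphic_algebras s m (*s) (E31 :: 'f ^ 3 \<Rightarrow> _) \<or>
          isomorphic_algebras s m (*s) (E32 :: 'f ^ 3 \<Rightarrow> _) \<or>
          (\<exists>\<alpha>\<in>R. isomorphic_algebras s m (*s) (E33 \<alpha>)) \<or>
          isomorphic_algebras s m (*s) (E34 :: 'f ^ 3 \<Rightarrow> _)"
  proof (intro allI impI)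
    fix s :: "'f \<Rightarrow> 'v \<Rightarrow> 'v" and m
    assume "evolution_algebra s m \<and> vector_space.dim s UNIV = 3 \<and> nilpotent_algebra s m"
    then obtain a b c where "isomorphic_algebras (*s) (triangular_mult a b c) s m"
      using nilpotent_evolution_isomorphic_triangular by blast
    then have "isomorphic_algebras (*s) n (*s) (triangular_mult a b c) \<Longrightarrow>
        isomorphic_algebras s m (*s) n" for n :: "'f ^ 3 \<Rightarrow> _"
      by (blast intro: isomorphic_algebras_sym isomorphic_algebras_trans)
    then show "isomorphic_algebras s m (*s) (E31 :: 'f ^ 3 \<Rightarrow> _) \<or>
          isomorphic_algebras s m (*s) (E32 :: 'f ^ 3 \<Rightarrow> _) \<or>
          (\<exists>\<alpha>\<in>R. isomorphic_algebras s m (*s) (E33 \<alpha>)) \<or>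
          isomorphic_algebras s m (*s) (E34 :: 'f ^ 3 \<Rightarrow> _)"
      using triangular_normal_form[OF assms, of a b c] by blast
  qed
  show "\<forall>\<alpha>\<in>R. \<forall>\<beta>\<in>R. \<alpha> \<noteq> \<beta> \<longrightarrow> \<not> isomorphic_algebras (*s) (E33 \<alpha>) (*s) (E33 \<beta>)"
    using E33_isomorphic_imp_same_square_class square_class_representative_unique[OF assms] nonzero
    by metis
  show "\<not> isomorphic_algebras (*s) (E31 :: 'f ^ 3 \<Rightarrow> _) (*s) (E32 :: 'f ^ 3 \<Rightarrow> _)"
    "\<forall>\<alpha>\<in>R. \<not> isomorphic_algebras (*s) (E31 :: 'f ^ 3 \<Rightarrow> _) (*s) (E33 \<alpha>)"
    "\<not> isomorphic_algebras (*s) (E31 :: 'f ^ 3 \<Rightarrow> _) (*s) (E34 :: 'f ^ 3 \<Rightarrow> _)"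
    "\<forall>\<alpha>\<in>R. \<not> isomorphic_algebras (*s) (E32 :: 'f ^ 3 \<Rightarrow> _) (*s) (E33 \<alpha>)"
    "\<not> isomorphic_algebras (*s) (E32 :: 'f ^ 3 \<Rightarrow> _) (*s) (E34 :: 'f ^ 3 \<Rightarrow> _)"
    by (auto dest!: isomorphic_algebras_dim_annihilator simp: dim_annihilators nonzero
        simp del: vec.dim_UNIV)
  show "\<forall>\<alpha>\<in>R. \<not> isomorphic_algebras (*s) (E33 \<alpha>) (*s) (E34 :: 'f ^ 3 \<Rightarrow> _)"
    by (simp add: E33_not_isomorphic_E34)
  show "std_nilpotent_evolution (E31 :: 'f ^ 3 \<Rightarrow> _)" "std_nilpotent_evolution (E32 :: 'f ^ 3 \<Rightarrow> _)"
    "\<forall>\<alpha>\<in>R. std_nilpotent_evolution (E33 \<alpha>)" "std_nilpotent_evolution (E34 :: 'f ^ 3 \<Rightarrow> _)"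
    by (simp_all add: E_eq_triangular std_nilpotent_evolution_triangular)
qed (simp_all add: algebra_Aut_E31 algebra_Aut_E32 algebra_Aut_E33 algebra_Aut_E34
    B_forms_normal_forms H_forms_normal_forms annihilators
    square_class_representative_nonzero[OF assms])

end
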